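(* Let $P_1P_2\dots P_n$ be a convex polygon and let $A_1,\dots,A_m$ be points inside this polygon such that $\{P_1,\dots,P_n\}\cup\{A_1,\dots,A_m\}$ is in general$^+$ position. Let $c_1,\dots,c_n$ be nonnegative integers with $\sum_{i=1}^n c_i=m$. Then there exists a subdivision of the area inside the polygon $P_1\dots P_n$ into parts $R_1,\dots,R_n$ such that each $R_i$ is convex, has $P_iP_{i+1}$ as an edge, has no point of $\{A_1,\dots,A_m\}$ on its boundary, has exactly $c_i$ points of $\{A_1,\dots,A_m\}$ in its interior, and no two of the $R_i$ overlap.
   Context: Indices are taken cyclically, so $P_{n+1}=P_1$. A point set is in general position if no three of its points are collinear. It is in general$^+$ position if it is in general position and no three lines, each passing through two points of the set, with the six points involved being distinct, are concurrent. *)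

theory Defs
  imports "HOL-Analysis.Analysis"
begin

text \<open>Vertices are indexed by \<open>0, \<dots>, n - 1\<close>, with \<open>Suc i mod n\<close> as the cyclic successor of \<open>i\<close>.\<close>

definition polygon_side :: "nat \<Rightarrow> (nat \<Rightarrow> real^2) \<Rightarrow> nat \<Rightarrow> (real^2) set" where
  "polygon_side n P i = closed_segment (P i) (P (Suc i mod n))"

definition polygon_region :: "nat \<Rightarrow> (nat \<Rightarrow> real^2) \<Rightarrow> (real^2) set" where
  "polygon_region n P = convex hull (P ` {..<n})"

text \<open>The last conjunct forces the vertices to be listed in their order along the boundary
  (in either orientation).\<close>

definition convex_polygon :: "nat \<Rightarrow> (nat \<Rightarrow> real^2) \<Rightarrow> bool" where
  "convex_polygon n P \<longleftrightarrow>
     3 \<le> n \<and> inj_on P {..<n} \<and>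
     (\<forall>i<n. P i extreme_point_of polygon_region n P) \<and>
     (\<forall>i<n. polygon_side n P i edge_of polygon_region n P)"

definition general_position :: "(real^2) set \<Rightarrow> bool" where
  "general_position S \<longleftrightarrow>
     (\<forall>x\<in>S. \<forall>y\<in>S. \<forall>z\<in>S. distinct [x, y, z] \<longrightarrow> \<not> collinear {x, y, z})"

definition general_plus_position :: "(real^2) set \<Rightarrow> bool" where
  "general_plus_position S \<longleftrightarrow> general_position S \<and>
     (\<forall>a\<in>S. \<forall>b\<in>S. \<forall>c\<in>S. \<forall>d\<in>S. \<forall>e\<in>S. \<forall>f\<in>S. distinct [a, b, c, d, e, f] \<longrightarrow>
        affine hull {a, b} \<inter> affine hull {c, d} \<inter> affine hull {e, f} = {})"

text \<open>Parts are closed regions, so that neighbouring parts share their common boundary. The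
  interior of a part must be nonempty: otherwise a segment would count as a part, with itself
  as an edge.\<close>

definition subdivides :: "nat \<Rightarrow> (nat \<Rightarrow> (real^2) set) \<Rightarrow> (real^2) set \<Rightarrow> bool" where
  "subdivides n R S \<longleftrightarrow>
     (\<Union>i<n. R i) = S \<and> (\<forall>i<n. closed (R i) \<and> interior (R i) \<noteq> {})"

definition overlap :: "(real^2) set \<Rightarrow> (real^2) set \<Rightarrow> bool" where
  "overlap S T \<longleftrightarrow> interior S \<inter> interior T \<noteq> {}"

end

theory Submission
  imports Defs
begin

text \<open>Let \<open>f\<^sub>i\<close> be affine functions such that on each edge \<open>i\<close> of the polygon \<open>f\<^sub>i\<close> is the smallest, strictly
  so inside the edge. The regions where \<open>f\<^sub>i\<close> is minimal are then convex, have the edges as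
  edges, and do not overlap, and it remains to choose the \<open>f\<^sub>i\<close> so that each region gets the prescribed
  number of points and no point has two minimal functions.

  Start with positive multiples of the distances to the edge lines. Minimizing the sum of the
  logarithms of the distances over all assignments of points to edges with the prescribed counts,
  the dual potentials are the logarithms of multipliers for which every point is assigned to one of
  its minimal functions. Remaining ties are broken by a first-order perturbation that changes
  the common values \<open>h\<^sub>v\<close> of the adjacent functions at the vertices. To first order this is again an
  assignment problem on the tied pairs, and it has a strict solution unless the cost vanishes around
  a cycle of ties. For generic \<open>h\<close> this would have to hold identically in \<open>h\<close>. By general position such a
  cycle passes through all edges, by planarity it does so in their order along the boundary, and then
  the lines joining its points to the vertices of the polygon are concurrent, against general\<open>\<^sup>+\<close>
  position, or parallel, against boundedness.\<close>

section \<open>Assignments and potentials\<close>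

fun path_weight :: "('a \<Rightarrow> 'a \<Rightarrow> real) \<Rightarrow> 'a list \<Rightarrow> real" where
  "path_weight w (x # y # zs) = w x y + path_weight w (y # zs)"
| "path_weight w _ = 0"

lemma path_weight_append:
  "path_weight w (xs @ y # zs) = path_weight w (xs @ [y]) + path_weight w (y # zs)"
proof (induction xs)
  case (Cons a xs)
  then show ?case by (cases xs) auto
qed simp

lemma path_weight_snoc:
  "xs \<noteq> [] \<Longrightarrow> path_weight w (xs @ [y]) = path_weight w xs + w (last xs) y"
proof (induction xs)
  case (Cons a xs)
  then show ?case by (cases xs) auto
qed simp

lemma path_weight_eq_sum:
  "path_weight w xs = (\<Sum>j<length xs - 1. w (xs ! j) (xs ! Suc j))"
proof (induction w xs rule: path_weight.induct)
  case (1 w x y zs)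
  then show ?case by (simp add: sum.lessThan_Suc_shift del: sum.lessThan_Suc)
qed auto

lemma path_weight_closed:
  assumes "xs \<noteq> []"
  shows "path_weight w (xs @ [hd xs]) = (\<Sum>j<length xs. w (xs ! j) (xs ! (Suc j mod length xs)))"
proof -
  have "w ((xs @ [hd xs]) ! j) ((xs @ [hd xs]) ! Suc j) = w (xs ! j) (xs ! (Suc j mod length xs))"
    if "j < length xs" for j
  proof (cases "Suc j < length xs")
    case False
    then have "Suc j = length xs" using that by simp
    then show ?thesis using assms that by (simp add: nth_append hd_conv_nth)
  qed (simp add: nth_append)
  then show ?thesis by (simp add: path_weight_eq_sum del: sum.lessThan_Suc)
qed

text \<open>Shortest-path potentials: \<open>v y\<close> is the least weight of a simple path ending
  at \<open>y\<close>, from any start. Simple paths keep the minimum over a finite set, and for them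
  nonnegativity of the simple cycles suffices.\<close>

lemma potential_exists:
  fixes w :: "'a \<Rightarrow> 'a \<Rightarrow> real"
  assumes "finite V" and E: "\<And>x y. E x y \<Longrightarrow> x \<in> V \<and> y \<in> V"
    and cyc: "\<And>xs. \<lbrakk>xs \<noteq> []; distinct xs; set xs \<subseteq> V; successively E (xs @ [hd xs])\<rbrakk>
                \<Longrightarrow> 0 \<le> path_weight w (xs @ [hd xs])"
  obtains v where "\<And>x y. E x y \<Longrightarrow> v y \<le> v x + w x y"
proof -
  define paths where
    "paths y = {xs. xs \<noteq> [] \<and> distinct xs \<and> set xs \<subseteq> V \<and> last xs = y \<and> successively E xs}" for y
  define v where "v y = Min (path_weight w ` paths y)" for y
  have fin: "finite (paths y)" for y
    by (rule finite_subset[OF _ finite_subset_distinct[OF assms(1)]]) (auto simp: paths_def)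
  have le: "v y \<le> path_weight w xs" if "xs \<in> paths y" for xs y
    unfolding v_def using fin that by (intro Min_le) auto
  have "v y \<le> v x + w x y" if "E x y" for x y
  proof -
    have "[x] \<in> paths x" using E[OF that] by (auto simp: paths_def)
    then have "v x \<in> path_weight w ` paths x"
      unfolding v_def using fin by (intro Min_in) auto
    then obtain xs where xs: "xs \<in> paths x" and vx: "v x = path_weight w xs" by auto
    have suc: "successively E (xs @ [y])"
      using xs that by (auto simp: paths_def successively_append_iff)
    show ?thesis
    proof (cases "y \<in> set xs")
      case False
      then have "xs @ [y] \<in> paths y"
        using xs suc E[OF that] by (auto simp: paths_def)
      then have "v y \<le> path_weight w (xs @ [y])" by (rule le)
      then show ?thesis using xs vx by (simp add: path_weight_snoc paths_def)
    next
      case True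
      \<comment> \<open>The prefix up to \<open>y\<close> is itself a path to \<open>y\<close>. The
        rest, closed by the arc from \<open>x\<close> to \<open>y\<close>, is a simple cycle, so
        cutting it off does not increase the weight.\<close>
      then obtain ys zs where xs_eq: "xs = ys @ y # zs" by (meson split_list)
      have "ys @ [y] \<in> paths y"
        using xs by (auto simp: paths_def xs_eq successively_append_iff)
      then have "v y \<le> path_weight w (ys @ [y])" by (rule le)
      moreover have "successively E ((y # zs) @ [hd (y # zs)])"
        using suc by (auto simp: xs_eq successively_append_iff)
      then have "0 \<le> path_weight w ((y # zs) @ [hd (y # zs)])"
        using xs by (intro cyc) (auto simp: paths_def xs_eq)
      moreover have "path_weight w ((y # zs) @ [hd (y # zs)]) = path_weight w (y # zs) + w x y"
        using xs path_weight_snoc[of "y # zs" w y] by (simp add: paths_def xs_eq)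
      ultimately show ?thesis
        by (simp add: vx xs_eq path_weight_append[of w ys y zs])
    qed
  qed
  then show ?thesis by (rule that)
qed

section \<open>Optimal assignments and their exchange cycles\<close>

text \<open>An entry \<open>(k, i)\<close> stands for \<open>k\<close> being assigned to
  \<open>i\<close>, and \<open>T k\<close> holds the values allowed for \<open>k\<close>. Rotating
  the cycle moves each \<open>k\<close> to the second component of the next entry.\<close>

definition exchange_cycle :: "('a \<Rightarrow> 'b set) \<Rightarrow> 'a set \<Rightarrow> ('a \<times> 'b) list \<Rightarrow> bool" where
  "exchange_cycle T K xs \<longleftrightarrow>
     2 \<le> length xs \<and> distinct (map fst xs) \<and> distinct (map snd xs) \<and>
     (\<forall>j<length xs. fst (xs ! j) \<in> K \<and> snd (xs ! j) \<in> T (fst (xs ! j)) \<and>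
        snd (xs ! (Suc j mod length xs)) \<in> T (fst (xs ! j)))"

definition exchange_cost :: "('a \<Rightarrow> 'b \<Rightarrow> real) \<Rightarrow> ('a \<times> 'b) list \<Rightarrow> real" where
  "exchange_cost C xs =
     (\<Sum>j<length xs. C (fst (xs ! j)) (snd (xs ! (Suc j mod length xs))) - C (fst (xs ! j)) (snd (xs ! j)))"

lemma finite_exchange_cycles:
  assumes "finite K" "finite I" "\<And>k. k \<in> K \<Longrightarrow> T k \<subseteq> I"
  shows "finite {xs. exchange_cycle T K xs}"
proof (rule finite_subset)
  show "finite {xs. set xs \<subseteq> K \<times> I \<and> distinct xs}"
    using assms by (intro finite_subset_distinct) auto
  show "{xs. exchange_cycle T K xs} \<subseteq> {xs. set xs \<subseteq> K \<times> I \<and> distinct xs}"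
  proof
    fix xs assume "xs \<in> {xs. exchange_cycle T K xs}"
    then have xs: "distinct (map fst xs)"
      "\<And>j. j < length xs \<Longrightarrow> fst (xs ! j) \<in> K \<and> snd (xs ! j) \<in> T (fst (xs ! j))"
      by (auto simp: exchange_cycle_def)
    have "x \<in> K \<times> I" if "x \<in> set xs" for x
      using that xs(2) assms(3) by (auto simp: in_set_conv_nth mem_Times_iff)
    with xs(1) show "xs \<in> {xs. set xs \<subseteq> K \<times> I \<and> distinct xs}"
      by (auto simp: distinct_map)
  qed
qed

lemma sum_cyclic_shift:
  fixes f :: "nat \<Rightarrow> 'a::comm_monoid_add"
  shows "(\<Sum>j<r. f (Suc j mod r)) = (\<Sum>j<r. f j)"
proof (cases r)
  case (Suc s)
  have "(\<Sum>j<s. f (Suc j mod r)) = (\<Sum>j<s. f (Suc j))"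
    by (rule sum.cong) (auto simp: Suc)
  then have "(\<Sum>j<r. f (Suc j mod r)) = (\<Sum>j<s. f (Suc j)) + f 0"
    by (simp add: Suc)
  then show ?thesis by (simp only: Suc sum.lessThan_Suc_shift add.commute)
qed simp

text \<open>Rotation along the cycle permutes the second components cyclically, so every value is
  taken as often as before.\<close>

lemma exchange:
  assumes "finite K" and xs: "exchange_cycle T K xs"
    and M: "\<And>j. j < length xs \<Longrightarrow> M (fst (xs ! j)) = snd (xs ! j)" and MT: "\<And>k. k \<in> K \<Longrightarrow> M k \<in> T k"
  obtains M' where "\<And>k. k \<in> K \<Longrightarrow> M' k \<in> T k"
    and "\<And>i. card {k \<in> K. M' k = i} = card {k \<in> K. M k = i}"
    and "\<And>C. (\<Sum>k\<in>K. C k (M' k)) = (\<Sum>k\<in>K. C k (M k)) + exchange_cost C xs"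
proof -
  define r where "r = length xs"
  define kk where "kk j = fst (xs ! j)" for j
  define rr where "rr j = snd (xs ! j)" for j
  have inj: "inj_on kk {..<r}"
    using xs by (auto simp: inj_on_def kk_def r_def exchange_cycle_def distinct_conv_nth)
  have kkK: "kk ` {..<r} \<subseteq> K"
    using xs by (auto simp: kk_def r_def exchange_cycle_def)
  define M' where
    "M' k = (if k \<in> kk ` {..<r} then rr (Suc (the_inv_into {..<r} kk k) mod r) else M k)" for k
  have M'kk: "M' (kk j) = rr (Suc j mod r)" if "j < r" for j
    using that by (auto simp: M'_def the_inv_into_f_f[OF inj])
  have Mkk: "M (kk j) = rr j" if "j < r" for j
    using that M by (auto simp: kk_def rr_def r_def)
  \<comment> \<open>Stated for arbitrary \<open>g\<close> because it serves twice: indicators of a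
    value give the counts, and \<open>C\<close> gives the cost.\<close>
  have key: "(\<Sum>k\<in>K. g k (M' k)) = (\<Sum>k\<in>K. g k (M k)) + (\<Sum>j<r. g (kk j) (rr (Suc j mod r)) - g (kk j) (rr j))"
    for g :: "'a \<Rightarrow> 'b \<Rightarrow> real"
  proof -
    have "(\<Sum>k\<in>K. g k (M' k)) - (\<Sum>k\<in>K. g k (M k)) = (\<Sum>k\<in>K. g k (M' k) - g k (M k))"
      by (simp add: sum_subtractf)
    also have "\<dots> = (\<Sum>k\<in>kk ` {..<r}. g k (M' k) - g k (M k))"
      using kkK assms(1) by (intro sum.mono_neutral_right) (auto simp: M'_def)
    also have "\<dots> = (\<Sum>j<r. g (kk j) (rr (Suc j mod r)) - g (kk j) (rr j))"
      by (subst sum.reindex[OF inj]) (auto simp: M'kk Mkk intro!: sum.cong)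
    finally show ?thesis by simp
  qed
  show ?thesis
  proof (rule that[of M'])
    show "M' k \<in> T k" if "k \<in> K" for k
    proof (cases "k \<in> kk ` {..<r}")
      case True
      then obtain j where j: "j < r" "k = kk j" by auto
      then have "rr (Suc j mod r) \<in> T (kk j)"
        using xs unfolding rr_def kk_def r_def exchange_cycle_def by blast
      then show ?thesis using j by (simp add: M'kk)
    qed (use MT that in \<open>simp add: M'_def\<close>)
    show "card {k \<in> K. M' k = i} = card {k \<in> K. M k = i}" for i
    proof -
      have c: "real (card {k \<in> K. N k = i}) = (\<Sum>k\<in>K. of_bool (N k = i))" for N
        using assms(1) by (simp add: of_bool_def sum.If_cases Int_def)
      have "real (card {k \<in> K. M' k = i}) = real (card {k \<in> K. M k = i})"
        unfolding c key[of "\<lambda>k a. of_bool (a = i)"] sum_subtractf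
          sum_cyclic_shift[of "\<lambda>j. of_bool (rr j = i)"] by simp
      then show ?thesis by simp
    qed
    show "(\<Sum>k\<in>K. C k (M' k)) = (\<Sum>k\<in>K. C k (M k)) + exchange_cost C xs" for C
      unfolding key exchange_cost_def by (simp add: kk_def rr_def r_def)
  qed
qed

text \<open>Linear programming duality for the assignment problem. The slack \<open>\<eta>\<close> serves to get
  strict inequalities when the optimum is unique.\<close>

lemma assignment_potentials:
  fixes C :: "'a \<Rightarrow> 'b \<Rightarrow> real"
  assumes "finite K" "finite I" and T: "\<And>k. k \<in> K \<Longrightarrow> T k \<subseteq> I"
    and MT: "\<And>k. k \<in> K \<Longrightarrow> M k \<in> T k"
    and eta: "\<And>xs. \<lbrakk>exchange_cycle T K xs; \<And>j. j < length xs \<Longrightarrow> M (fst (xs ! j)) = snd (xs ! j)\<rbrakk>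
                \<Longrightarrow> real (length xs) * \<eta> \<le> exchange_cost C xs"
  obtains u where "\<And>k i. \<lbrakk>k \<in> K; i \<in> T k; i \<noteq> M k\<rbrakk> \<Longrightarrow> C k (M k) + u (M k) + \<eta> \<le> C k i + u i"
proof -
  define S where "S x y = {k \<in> K. M k = x \<and> y \<in> T k}" for x y
  define E where "E x y \<longleftrightarrow> x \<noteq> y \<and> S x y \<noteq> {}" for x y
  have finS: "finite (S x y)" for x y using assms(1) by (simp add: S_def)
  \<comment> \<open>The arc from \<open>x\<close> to \<open>y\<close> carries the least cost of
    moving one element from \<open>x\<close> to \<open>y\<close>. Charging \<eta> on every arc turns
    the hypothesis on exchange cycles into nonnegativity of cycles.\<close>
  define w where "w x y = Min ((\<lambda>k. C k y - C k x) ` S x y) - \<eta>" for x y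
  have "\<exists>k \<in> S x y. w x y = C k y - C k x - \<eta>" if "S x y \<noteq> {}" for x y
  proof -
    have "Min ((\<lambda>k. C k y - C k x) ` S x y) \<in> (\<lambda>k. C k y - C k x) ` S x y"
      using finS that by (intro Min_in) auto
    then show ?thesis by (auto simp: w_def)
  qed
  then obtain kap where kap: "\<And>x y. E x y \<Longrightarrow> kap x y \<in> S x y"
    and w_kap: "\<And>x y. E x y \<Longrightarrow> w x y = C (kap x y) y - C (kap x y) x - \<eta>"
    unfolding E_def by metis
  obtain v where v: "\<And>x y. E x y \<Longrightarrow> v y \<le> v x + w x y"
  proof (rule potential_exists[of I E w])
    show "finite I" by fact
    show "x \<in> I \<and> y \<in> I" if "E x y" for x y
      using that T MT by (auto simp: E_def S_def)
    show "0 \<le> path_weight w (xs @ [hd xs])"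
      if xs: "xs \<noteq> []" "distinct xs" "set xs \<subseteq> I" "successively E (xs @ [hd xs])" for xs
    proof -
      define r where "r = length xs"
      define s where "s j = Suc j mod r" for j
      have r0: "0 < r" using xs by (simp add: r_def)
      have r1: "r \<noteq> 1"
      proof
        assume "r = 1"
        then obtain x where "xs = [x]" unfolding r_def by (metis length_0_conv length_Suc_conv One_nat_def)
        then show False using xs(4) by (simp add: E_def)
      qed
      have arc: "E (xs ! j) (xs ! s j)" if "j < r" for j
      proof -
        have "E ((xs @ [hd xs]) ! j) ((xs @ [hd xs]) ! Suc j)"
          using xs(4) that by (auto simp: successively_conv_nth r_def)
        moreover have "(xs @ [hd xs]) ! Suc j = xs ! s j"
        proof (cases "Suc j < r")
          case False
          then have "Suc j = r" using that by simp
          then show ?thesis using xs by (simp add: s_def r_def nth_append hd_conv_nth)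
        qed (simp add: s_def r_def nth_append)
        ultimately show ?thesis using that by (simp add: r_def nth_append)
      qed
      \<comment> \<open>The cycle of values is lifted to an exchange cycle by taking the cheapest
        element to move on each arc.\<close>
      define zs where "zs = map (\<lambda>j. (kap (xs ! j) (xs ! s j), xs ! j)) [0..<r]"
      have len: "length zs = r" by (simp add: zs_def)
      have nth: "zs ! j = (kap (xs ! j) (xs ! s j), xs ! j)" if "j < r" for j
        using that by (simp add: zs_def)
      have sr: "s j < r" for j using r0 by (simp add: s_def)
      have MZ: "M (fst (zs ! j)) = snd (zs ! j)" if "j < length zs" for j
        using kap[OF arc, of j] that by (simp add: len nth S_def)
      \<comment> \<open>The chosen elements are distinct because \<open>M\<close> maps them to the
        distinct entries of \<open>xs\<close>.\<close>
      have "map M (map fst zs) = map snd zs"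
        by (rule nth_equalityI) (auto simp: MZ)
      moreover have "map snd zs = xs"
        by (rule nth_equalityI) (auto simp: nth len r_def[symmetric])
      ultimately have dist: "distinct (map fst zs)" "distinct (map snd zs)"
        using xs(2) distinct_map[of M "map fst zs"] by auto
      have "exchange_cycle T K zs"
        unfolding exchange_cycle_def
      proof (intro conjI allI impI dist)
        show "2 \<le> length zs" using r0 r1 len by simp
        fix j assume j: "j < length zs"
        show "fst (zs ! j) \<in> K"
          using kap[OF arc, of j] j by (simp add: len nth S_def)
        then show "snd (zs ! j) \<in> T (fst (zs ! j))"
          using MT MZ[OF j] by metis
        show "snd (zs ! (Suc j mod length zs)) \<in> T (fst (zs ! j))"
          using kap[OF arc, of j] j sr[of j] nth[OF sr, of j] by (simp add: len nth S_def flip: s_def)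
      qed
      then have "real r * \<eta> \<le> exchange_cost C zs" using eta MZ len by metis
      also have "\<dots> = (\<Sum>j<r. w (xs ! j) (xs ! s j) + \<eta>)"
        unfolding exchange_cost_def len s_def[symmetric]
        by (rule sum.cong) (auto simp: w_kap[OF arc] nth sr)
      also have "\<dots> = path_weight w (xs @ [hd xs]) + real r * \<eta>"
        by (simp add: path_weight_closed[OF xs(1)] s_def r_def sum.distrib)
      finally show ?thesis by simp
    qed
  qed blast
  show ?thesis
  proof (rule that[of "\<lambda>i. - v i"])
    fix k i assume k: "k \<in> K" "i \<in> T k" "i \<noteq> M k"
    then have kS: "k \<in> S (M k) i" by (simp add: S_def)
    then have "v i \<le> v (M k) + w (M k) i" using k by (intro v) (auto simp: E_def)
    moreover have "w (M k) i \<le> C k i - C k (M k) - \<eta>"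
      unfolding w_def using kS finS by (auto intro!: Min_le)
    ultimately show "C k (M k) + - v (M k) + \<eta> \<le> C k i + - v i" by simp
  qed
qed

text \<open>Take an assignment of least cost among those with the counts of \<open>M0\<close>:
  rotating an exchange cycle of negative cost would improve it.\<close>

lemma optimal_assignment:
  fixes C :: "'a \<Rightarrow> 'b \<Rightarrow> real"
  assumes "finite K" "finite I" and T: "\<forall>k\<in>K. T k \<subseteq> I"
    and M0: "\<forall>k\<in>K. M0 k \<in> T k"
  shows "\<exists>M. (\<forall>k\<in>K. M k \<in> T k) \<and> (\<forall>i. card {k \<in> K. M k = i} = card {k \<in> K. M0 k = i}) \<and>
    (\<forall>xs. exchange_cycle T K xs \<and> (\<forall>j<length xs. M (fst (xs ! j)) = snd (xs ! j)) \<longrightarrow>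
       0 \<le> exchange_cost C xs)"
proof -
  define Ms where "Ms = {M. (\<forall>k\<in>K. M k \<in> T k) \<and> (\<forall>i. card {k \<in> K. M k = i} = card {k \<in> K. M0 k = i})}"
  define cost where "cost M = (\<Sum>k\<in>K. C k (M k))" for M
  \<comment> \<open>Members of \<open>Ms\<close> are arbitrary outside \<open>K\<close>, so
    \<open>Ms\<close> itself may be infinite. The cost sees only the values on
    \<open>K\<close>.\<close>
  have "cost ` Ms \<subseteq> cost ` (K \<rightarrow>\<^sub>E I)"
  proof
    fix y assume "y \<in> cost ` Ms"
    then obtain M where "M \<in> Ms" "y = cost M" by auto
    then have "y = cost (restrict M K)" "restrict M K \<in> K \<rightarrow>\<^sub>E I"
      using T by (auto simp: cost_def Ms_def)
    then show "y \<in> cost ` (K \<rightarrow>\<^sub>E I)" by blast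
  qed
  then have fin: "finite (cost ` Ms)"
    using assms(1,2) by (meson finite_PiE finite_imageI finite_subset)
  have "M0 \<in> Ms" using M0 by (auto simp: Ms_def)
  then have "Min (cost ` Ms) \<in> cost ` Ms" using fin by (intro Min_in) auto
  then obtain M where M: "M \<in> Ms" "cost M = Min (cost ` Ms)" by auto
  then have min: "cost M \<le> cost M'" if "M' \<in> Ms" for M'
    using fin that by simp
  show ?thesis
  proof (intro exI[of _ M] conjI ballI allI impI; (elim conjE)?)
    show "M k \<in> T k" if "k \<in> K" for k using M that by (simp add: Ms_def)
    show "card {k \<in> K. M k = i} = card {k \<in> K. M0 k = i}" for i using M by (simp add: Ms_def)
    show "0 \<le> exchange_cost C xs"
      if xs: "exchange_cycle T K xs" "\<forall>j<length xs. M (fst (xs ! j)) = snd (xs ! j)" for xs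
    proof -
      obtain M' where M': "\<And>k. k \<in> K \<Longrightarrow> M' k \<in> T k"
        "\<And>i. card {k \<in> K. M' k = i} = card {k \<in> K. M k = i}"
        "cost M' = cost M + exchange_cost C xs"
        unfolding cost_def
        by (rule exchange[OF assms(1) xs(1), of M]) (use M xs(2) in \<open>auto simp: Ms_def\<close>)
      then have "M' \<in> Ms" using M by (simp add: Ms_def)
      then show ?thesis using min M'(3) by fastforce
    qed
  qed
qed

text \<open>Without cycles of cost zero, the exchange cycles at an optimum have positive cost. They
  are finitely many, so one positive slack fits all of them.\<close>

lemma strict_assignment:
  fixes C :: "'a \<Rightarrow> 'b \<Rightarrow> real"
  assumes "finite K" "finite I" and T: "\<And>k. k \<in> K \<Longrightarrow> T k \<subseteq> I"
    and M0: "\<And>k. k \<in> K \<Longrightarrow> M0 k \<in> T k"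
    and generic: "\<And>xs. exchange_cycle T K xs \<Longrightarrow> exchange_cost C xs \<noteq> 0"
  obtains M u where "\<And>k. k \<in> K \<Longrightarrow> M k \<in> T k"
    and "\<And>i. card {k \<in> K. M k = i} = card {k \<in> K. M0 k = i}"
    and "\<And>k i. \<lbrakk>k \<in> K; i \<in> T k; i \<noteq> M k\<rbrakk> \<Longrightarrow> C k (M k) + u (M k) < C k i + u i"
proof -
  obtain M where M1: "\<forall>k\<in>K. M k \<in> T k"
    and M2: "\<forall>i. card {k \<in> K. M k = i} = card {k \<in> K. M0 k = i}"
    and M3: "\<forall>xs. exchange_cycle T K xs \<and> (\<forall>j<length xs. M (fst (xs ! j)) = snd (xs ! j)) \<longrightarrow>
                0 \<le> exchange_cost C xs"
  proof -
    have "\<forall>k\<in>K. T k \<subseteq> I" "\<forall>k\<in>K. M0 k \<in> T k" using T M0 by auto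
    from optimal_assignment[OF assms(1,2) this, of C]
    show ?thesis by (elim exE conjE) (rule that)
  qed
  define Z where "Z = {xs. exchange_cycle T K xs \<and> (\<forall>j<length xs. M (fst (xs ! j)) = snd (xs ! j))}"
  have "finite Z"
    by (rule finite_subset[OF _ finite_exchange_cycles[where T = T, OF assms(1,2)]]) (use T in \<open>auto simp: Z_def\<close>)
  have "\<forall>xs\<in>Z. \<forall>\<^sub>F \<eta> in at_right 0. real (length xs) * \<eta> < exchange_cost C xs"
  proof
    fix xs assume "xs \<in> Z"
    then have "0 < exchange_cost C xs" using M3 generic[of xs] by (auto simp: Z_def order.strict_iff_order)
    moreover have "((\<lambda>\<eta>. real (length xs) * \<eta>) \<longlongrightarrow> real (length xs) * 0) (at_right 0)"
      by (intro tendsto_intros)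
    ultimately show "\<forall>\<^sub>F \<eta> in at_right 0. real (length xs) * \<eta> < exchange_cost C xs"
      by (auto dest: order_tendstoD)
  qed
  then have "\<forall>\<^sub>F \<eta> in at_right 0. (\<forall>xs\<in>Z. real (length xs) * \<eta> < exchange_cost C xs) \<and> 0 < \<eta>"
    using \<open>finite Z\<close>
    by (intro eventually_conj eventually_ball_finite) (auto intro: eventually_at_right_less)
  then obtain \<eta> where eta: "\<And>xs. xs \<in> Z \<Longrightarrow> real (length xs) * \<eta> < exchange_cost C xs" "0 < \<eta>"
    by (metis (no_types, lifting) eventually_happens trivial_limit_at_right_real)
  obtain u where u: "\<And>k i. \<lbrakk>k \<in> K; i \<in> T k; i \<noteq> M k\<rbrakk> \<Longrightarrow> C k (M k) + u (M k) + \<eta> \<le> C k i + u i"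
  proof (rule assignment_potentials[where T = T and M = M and \<eta> = \<eta> and C = C, OF assms(1,2)])
    show "real (length xs) * \<eta> \<le> exchange_cost C xs"
      if "exchange_cycle T K xs" "\<And>j. j < length xs \<Longrightarrow> M (fst (xs ! j)) = snd (xs ! j)" for xs
      using eta(1)[of xs] that by (simp add: Z_def)
  qed (use T M1 in blast)+
  show ?thesis
    by (rule that[of M u]) (use M1 M2 u eta(2) in \<open>force+\<close>)
qed

section \<open>The forms of the edges of a convex polygon\<close>

text \<open>Homogeneous coordinates: the affine function \<open>a \<bullet> x + b\<close> is encoded
  as the vector \<open>(a, b)\<close>, whose inner product with \<open>homog x\<close> is its value.
  Affine functions and points of the plane thus live in the same three-dimensional space.\<close>

definition homog :: "'a \<Rightarrow> 'a \<times> real" where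
  "homog x = (x, 1)"

lemma continuous_on_homog [continuous_intros]:
  "continuous_on S f \<Longrightarrow> continuous_on S (\<lambda>x. homog (f x))"
  for f :: "'b::topological_space \<Rightarrow> 'a::topological_space"
  unfolding homog_def by (intro continuous_intros)

lemma homog_affine:
  "u + v = 1 \<Longrightarrow> homog (u *\<^sub>R x + v *\<^sub>R y) = u *\<^sub>R homog x + v *\<^sub>R homog y"
  for x :: "'a::real_vector"
  by (simp add: homog_def)

text \<open>The space has dimension three. Coefficients are used rather than a dependent set so that
  coinciding vectors are covered.\<close>

lemma plane_dependent:
  fixes a b c d :: "(real^2) \<times> real"
  obtains p q r s where "p *\<^sub>R a + q *\<^sub>R b + r *\<^sub>R c + s *\<^sub>R d = 0" "p \<noteq> 0 \<or> q \<noteq> 0 \<or> r \<noteq> 0 \<or> s \<noteq> 0"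
proof (cases "distinct [a, b, c, d]")
  case True
  then have "dependent {a, b, c, d}" by (intro dependent_biggerset) auto
  then obtain u where u: "(\<Sum>v\<in>{a, b, c, d}. u v *\<^sub>R v) = 0" "\<exists>v\<in>{a, b, c, d}. u v \<noteq> 0"
    by (auto simp: dependent_finite)
  then show ?thesis
    using True by (intro that[of "u a" "u b" "u c" "u d"]) (auto simp: add.assoc)
next
  case False
  then consider "a = b" | "a = c" | "a = d" | "b = c" | "b = d" | "c = d" by auto
  then show ?thesis
    by cases
      (use that[of 1 "-1" 0 0] that[of 1 0 "-1" 0] that[of 1 0 0 "-1"] that[of 0 1 "-1" 0]
           that[of 0 1 0 "-1"] that[of 0 0 1 "-1"] in auto)
qed

definition cross2 :: "real^2 \<Rightarrow> real^2 \<Rightarrow> real" where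
  "cross2 x y = x $ 1 * y $ 2 - x $ 2 * y $ 1"

lemma cross2_eq_0:
  assumes "cross2 e y = 0" "e \<noteq> 0"
  obtains c where "y = c *\<^sub>R e"
proof (cases "e $ 1 = 0")
  case False
  then have "y = (y $ 1 / e $ 1) *\<^sub>R e"
    using assms by (simp add: vec_eq_iff forall_2 cross2_def field_simps)
  then show ?thesis by (rule that)
next
  case True
  then have "e $ 2 \<noteq> 0" using assms by (auto simp: vec_eq_iff forall_2)
  then have "y = (y $ 2 / e $ 2) *\<^sub>R e"
    using assms True by (simp add: vec_eq_iff forall_2 cross2_def field_simps)
  then show ?thesis by (rule that)
qed

lemma affine_zero:
  fixes a b :: real
  assumes "a * b \<le> 0" "a \<noteq> b"
  obtains s where "0 \<le> s" "s \<le> 1" "(1 - s) * a + s * b = 0"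
proof (rule that[of "a / (a - b)"])
  consider "0 \<le> a" "b \<le> 0" | "a \<le> 0" "0 \<le> b"
    using assms(1) by (auto simp: mult_le_0_iff)
  then show "0 \<le> a / (a - b)" "a / (a - b) \<le> 1"
    using assms(2) by (cases; auto simp: divide_simps)+
  show "(1 - a / (a - b)) * a + a / (a - b) * b = 0"
    using assms by (simp add: field_simps)
qed

text \<open>The conditions are invariant under scaling each form by a positive factor, so the locale
  applies to the original and to the rescaled forms alike.\<close>

locale edge_forms =
  fixes n :: nat and P :: "nat \<Rightarrow> real^2" and F :: "nat \<Rightarrow> (real^2) \<times> real"
  assumes n3: "3 \<le> n"
    and F_left: "i < n \<Longrightarrow> F i \<bullet> homog (P i) = 0"
    and F_right: "i < n \<Longrightarrow> F i \<bullet> homog (P (Suc i mod n)) = 0"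
    and F_pos: "\<lbrakk>i < n; v < n; v \<noteq> i; v \<noteq> Suc i mod n\<rbrakk> \<Longrightarrow> 0 < F i \<bullet> homog (P v)"
begin

lemma Suc_mod_less [simp]: "Suc i mod n < n" using n3 by simp

lemma Suc_mod_inj: "i < n \<Longrightarrow> j < n \<Longrightarrow> Suc i mod n = Suc j mod n \<longleftrightarrow> i = j"
  by (auto simp: mod_Suc split: if_splits)

lemma Suc_mod_neq: "i < n \<Longrightarrow> Suc i mod n \<noteq> i"
  using n3 by (auto simp: mod_Suc)

lemma Suc_Suc_mod_neq: "i < n \<Longrightarrow> Suc (Suc i mod n) mod n \<noteq> i"
  using n3 by (auto simp: mod_Suc)

lemma F_nonneg_vertex: "i < n \<Longrightarrow> v < n \<Longrightarrow> 0 \<le> F i \<bullet> homog (P v)"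
  using F_pos[of i v] F_left F_right by (cases "v = i \<or> v = Suc i mod n") force+

lemma F_nonneg:
  assumes "i < n" "x \<in> polygon_region n P"
  shows "0 \<le> F i \<bullet> homog x"
proof -
  have "polygon_region n P \<subseteq> {x. 0 \<le> F i \<bullet> homog x}"
    unfolding polygon_region_def
  proof (rule hull_minimal)
    show "P ` {..<n} \<subseteq> {x. 0 \<le> F i \<bullet> homog x}" using F_nonneg_vertex assms by auto
    show "convex {x. 0 \<le> F i \<bullet> homog x}"
      unfolding convex_def by (auto simp: homog_affine inner_add_right)
  qed
  then show ?thesis using assms by auto
qed

lemma vertex_in [simp]: "v < n \<Longrightarrow> P v \<in> polygon_region n P"
  unfolding polygon_region_def by (rule hull_inc) auto

lemma inj_P: "inj_on P {..<n}"
proof (rule inj_onI)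
  fix v w assume vw: "v \<in> {..<n}" "w \<in> {..<n}" "P v = P w"
  show "v = w"
  proof (rule ccontr)
    assume "v \<noteq> w"
    show False
    proof (cases "w = Suc v mod n")
      case False
      then show False using F_pos[of v w] F_left[of v] vw \<open>v \<noteq> w\<close> by auto
    next
      case True
      then have "v \<noteq> Suc w mod n" using vw Suc_Suc_mod_neq[of v] by auto
      then show False using F_pos[of w v] F_left[of w] vw \<open>v \<noteq> w\<close> by auto
    qed
  qed
qed

text \<open>Sample points of the edges: at \<open>mid i\<close> only the form of edge
  \<open>i\<close> vanishes, whereas at a vertex two forms do.\<close>

definition mid :: "nat \<Rightarrow> real^2" where
  "mid i = (1/2) *\<^sub>R P i + (1/2) *\<^sub>R P (Suc i mod n)"

lemma homog_mid: "homog (mid i) = (1/2) *\<^sub>R homog (P i) + (1/2) *\<^sub>R homog (P (Suc i mod n))"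
  unfolding mid_def by (rule homog_affine) simp

lemma mid_in: "i < n \<Longrightarrow> mid i \<in> polygon_region n P"
  unfolding mid_def polygon_region_def
  by (rule convexD[OF convex_convex_hull]) (auto intro: hull_inc)

lemma F_mid: "i < n \<Longrightarrow> F i \<bullet> homog (mid i) = 0"
  by (simp add: homog_mid inner_add_right F_left F_right)

text \<open>Two different edges share at most one end, so some end of edge \<open>i\<close> lies off
  edge \<open>j\<close>.\<close>

lemma F_mid_pos:
  assumes "i < n" "j < n" "j \<noteq> i"
  shows "0 < F j \<bullet> homog (mid i)"
proof -
  have "0 < F j \<bullet> homog (P i) \<or> 0 < F j \<bullet> homog (P (Suc i mod n))"
  proof (cases "i = Suc j mod n")
    case True
    then have "Suc i mod n \<noteq> j" using Suc_Suc_mod_neq assms by auto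
    moreover have "Suc i mod n \<noteq> Suc j mod n" using assms Suc_mod_inj by auto
    ultimately show ?thesis using F_pos assms by auto
  qed (use F_pos assms in auto)
  moreover have "0 \<le> F j \<bullet> homog (P i)" "0 \<le> F j \<bullet> homog (P (Suc i mod n))"
    using F_nonneg_vertex assms by auto
  ultimately show ?thesis by (auto simp: homog_mid inner_add_right)
qed

text \<open>At most two edge lines pass through a point.\<close>

lemma F_independent3:
  assumes "distinct [i, j, k]" "i < n" "j < n" "k < n"
    and "p *\<^sub>R F i + q *\<^sub>R F j + r *\<^sub>R F k = 0"
  shows "p = 0 \<and> q = 0 \<and> r = 0"
proof -
  have eq: "p * (F i \<bullet> homog x) + q * (F j \<bullet> homog x) + r * (F k \<bullet> homog x) = 0" for x
    using arg_cong[OF assms(5), of "\<lambda>v. v \<bullet> homog x"] by (simp add: inner_add_left)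
  note pos = F_mid_pos[of i j] F_mid_pos[of i k] F_mid_pos[of j i] F_mid_pos[of j k]
    F_mid_pos[of k i] F_mid_pos[of k j]
  have *: "a = 0 \<and> b = 0" if "a * x + b * y = 0" "0 < x" "0 < y" "0 \<le> a * b" for a b x y :: real
  proof -
    have "(a * x + b * y) * (a * x + b * y) = 0" using that by simp
    then have "(a * x)\<^sup>2 + (b * y)\<^sup>2 + 2 * (a * b) * (x * y) = 0" by (simp add: algebra_simps power2_eq_square)
    moreover have "0 \<le> 2 * (a * b) * (x * y)" using that by simp
    moreover have "0 \<le> (a * x)\<^sup>2" "0 \<le> (b * y)\<^sup>2" by simp_all
    ultimately have "(a * x)\<^sup>2 = 0" "(b * y)\<^sup>2 = 0" by linarith+
    then show ?thesis using that by simp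
  qed
  have 1: "q * (F j \<bullet> homog (mid i)) + r * (F k \<bullet> homog (mid i)) = 0"
    using eq[of "mid i"] F_mid assms by simp
  have 2: "p * (F i \<bullet> homog (mid j)) + r * (F k \<bullet> homog (mid j)) = 0"
    using eq[of "mid j"] F_mid assms by simp
  have 3: "p * (F i \<bullet> homog (mid k)) + q * (F j \<bullet> homog (mid k)) = 0"
    using eq[of "mid k"] F_mid assms by simp
  \<comment> \<open>Among three reals, two have weakly equal signs. The midpoint of the remaining
    edge shows that these two coefficients vanish, and another midpoint then gives the
    third.\<close>
  have "0 \<le> q * r \<or> 0 \<le> p * r \<or> 0 \<le> p * q"
    by (metis linorder_not_less mult_neg_neg mult_nonneg_nonneg nle_le)
  then show ?thesis
    using *[OF 1] *[OF 2] *[OF 3] 1 2 3 pos assms by force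
qed

text \<open>Pairing a dependency between the three forms and \<open>b\<close> with \<open>b\<close>
  leaves \<open>s * (b \<bullet> b) = 0\<close>, and \<open>s = 0\<close> is impossible by
  independence of the forms.\<close>

lemma F_separate:
  assumes "distinct [i, j, k]" "i < n" "j < n" "k < n"
    and "0 = F i \<bullet> b" "0 = F j \<bullet> b" "0 = F k \<bullet> b"
  shows "b = 0"
proof -
  obtain p q r s where rel: "p *\<^sub>R F i + q *\<^sub>R F j + r *\<^sub>R F k + s *\<^sub>R b = 0"
    and nz: "p \<noteq> 0 \<or> q \<noteq> 0 \<or> r \<noteq> 0 \<or> s \<noteq> 0"
    by (rule plane_dependent)
  have "p * (F i \<bullet> b) + q * (F j \<bullet> b) + r * (F k \<bullet> b) + s * (b \<bullet> b) = 0"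
    using arg_cong[OF rel, of "\<lambda>v. v \<bullet> b"] by (simp add: inner_add_left)
  then have sb: "s * (b \<bullet> b) = 0" using assms by simp
  show ?thesis
  proof (cases "s = 0")
    case True
    then show ?thesis using F_independent3[of i j k p q r] assms nz
      rel by simp
  qed (use sb in simp)
qed

text \<open>The kernel of \<open>F i\<close> is a plane, spanned by the ends of the edge. Pairing
  the dependency with \<open>F i\<close> removes its last coefficient, and the two ends are
  independent because they are distinct points.\<close>

lemma edge_decompose:
  assumes "i < n" "F i \<bullet> b = 0"
  obtains p q where "b = p *\<^sub>R homog (P i) + q *\<^sub>R homog (P (Suc i mod n))"
proof -
  let ?x = "homog (P i)" and ?y = "homog (P (Suc i mod n))"
  obtain p q r s where pq: "p *\<^sub>R ?x + q *\<^sub>R ?y + r *\<^sub>R b + s *\<^sub>R F i = 0"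
    and nz: "p \<noteq> 0 \<or> q \<noteq> 0 \<or> r \<noteq> 0 \<or> s \<noteq> 0"
    by (rule plane_dependent)
  have "p * (?x \<bullet> F i) + q * (?y \<bullet> F i) + r * (b \<bullet> F i) + s * (F i \<bullet> F i) = 0"
    using arg_cong[OF pq, of "\<lambda>v. v \<bullet> F i"] by (simp add: inner_add_left)
  moreover have "F i \<noteq> 0"
    using F_mid_pos[of "Suc i mod n" i] Suc_mod_neq[of i] assms by auto
  ultimately have s: "s = 0"
    using F_left F_right assms by (simp add: inner_commute)
  have "r \<noteq> 0"
  proof
    assume r: "r = 0"
    with pq s have e: "p *\<^sub>R P i + q *\<^sub>R P (Suc i mod n) = 0" "p + q = 0"
      by (simp_all add: homog_def zero_prod_def)
    then have "q = - p" by simp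
    with e have "p *\<^sub>R (P i - P (Suc i mod n)) = 0" by (simp add: scaleR_diff_right)
    moreover have "P i \<noteq> P (Suc i mod n)"
      using inj_P assms Suc_mod_neq[of i] by (auto simp: inj_on_def)
    ultimately have "p = 0" by simp
    with \<open>q = - p\<close> r s nz show False by simp
  qed
  have "b = (1 / r) *\<^sub>R (r *\<^sub>R b)" using \<open>r \<noteq> 0\<close> by simp
  also have "r *\<^sub>R b = - (p *\<^sub>R ?x + q *\<^sub>R ?y)"
    using pq s by (intro eq_neg_iff_add_eq_0[THEN iffD2]) (simp add: add.commute)
  finally have "b = (- p / r) *\<^sub>R ?x + (- q / r) *\<^sub>R ?y"
    by (simp add: scaleR_diff_right)
  then show ?thesis by (rule that)
qed

end

section \<open>Sign patterns for four edges and planarity\<close>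

lemma sum_zero_mixed_signs:
  fixes a b c d x y z w :: real
  assumes "0 < a" "0 < b" "0 < c" "0 < d" "a * x + b * y + c * z + d * w = 0"
    and "0 < x \<or> 0 < y \<or> 0 < z \<or> 0 < w"
  shows "x < 0 \<or> y < 0 \<or> z < 0 \<or> w < 0"
proof (rule ccontr)
  assume "\<not> ?thesis"
  then have "0 \<le> x" "0 \<le> y" "0 \<le> z" "0 \<le> w" by auto
  then have nn: "0 \<le> a * x" "0 \<le> b * y" "0 \<le> c * z" "0 \<le> d * w" using assms by simp_all
  then have "a * x = 0" "b * y = 0" "c * z = 0" "d * w = 0" using assms(5) by linarith+
  then show False using assms by simp
qed

lemma sum_zero_signs:
  fixes a b c d x y z w :: real
  assumes "0 < a" "0 < b" "0 < c" "0 < d" "a * x + b * y + c * z + d * w = 0"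
  shows "(0 < x \<or> 0 < y \<or> 0 < z \<or> 0 < w) \<longleftrightarrow> (x < 0 \<or> y < 0 \<or> z < 0 \<or> w < 0)"
proof -
  have "a * (- x) + b * (- y) + c * (- z) + d * (- w) = 0" using assms(5) by simp
  from sum_zero_mixed_signs[OF assms(1-4) this] sum_zero_mixed_signs[OF assms]
  show ?thesis by auto
qed

text \<open>Radon: in a dependency between the forms of four edges of a convex polygon, the
  coefficients of opposite edges have equal signs. The evaluations at points of the four edges
  and the crossing of the two diagonals are recorded by the equations below.\<close>

lemma crossing_signs:
  fixes p q r s :: real
  assumes pos: "0 < a1" "0 < a2" "0 < a3" "0 < b1" "0 < b2" "0 < b3"
      "0 < c1" "0 < c2" "0 < c3" "0 < d1" "0 < d2" "0 < d3" "0 < e1" "0 < e2" "0 < f1" "0 < f2"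
    and eq: "q * a1 + r * a2 + s * a3 = 0" "p * b1 + r * b2 + s * b3 = 0"
      "p * c1 + q * c2 + s * c3 = 0" "p * d1 + q * d2 + r * d3 = 0"
      "e1 * (r * a2) - e2 * (s * b3) = f1 * (p * c1) - f2 * (q * d2)"
      "e1 * (s * a3) - e2 * (r * b2) = f2 * (p * d1) - f1 * (q * c2)"
    and nz: "p \<noteq> 0 \<or> q \<noteq> 0 \<or> r \<noteq> 0 \<or> s \<noteq> 0"
  shows "(0 < p \<and> 0 < q \<and> r < 0 \<and> s < 0) \<or> (p < 0 \<and> q < 0 \<and> 0 < r \<and> 0 < s)"
proof -
  have 1: "(0 < q \<or> 0 < r \<or> 0 < s) \<longleftrightarrow> (q < 0 \<or> r < 0 \<or> s < 0)"
    using sum_zero_signs[of a1 a2 a3 1 q r s 0] pos eq(1) by (simp add: mult.commute)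
  have 2: "(0 < p \<or> 0 < r \<or> 0 < s) \<longleftrightarrow> (p < 0 \<or> r < 0 \<or> s < 0)"
    using sum_zero_signs[of b1 b2 b3 1 p r s 0] pos eq(2) by (simp add: mult.commute)
  have 3: "(0 < p \<or> 0 < q \<or> 0 < s) \<longleftrightarrow> (p < 0 \<or> q < 0 \<or> s < 0)"
    using sum_zero_signs[of c1 c2 c3 1 p q s 0] pos eq(3) by (simp add: mult.commute)
  have 4: "(0 < p \<or> 0 < q \<or> 0 < r) \<longleftrightarrow> (p < 0 \<or> q < 0 \<or> r < 0)"
    using sum_zero_signs[of d1 d2 d3 1 p q r 0] pos eq(4) by (simp add: mult.commute)
  \<comment> \<open>The first four equations leave only splits into two positive and two negative
    coefficients. The fifth excludes \<open>p\<close>, \<open>s\<close> against \<open>q\<close>,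
    \<open>r\<close>, and the sixth excludes \<open>p\<close>, \<open>r\<close> against
    \<open>q\<close>, \<open>s\<close>.\<close>
  have "(e1 * a2) * r + (e2 * b3) * (- s) + (f1 * c1) * (- p) + (f2 * d2) * q = 0"
    using eq(5) by (simp add: mult_ac)
  then have 5: "(0 < r \<or> 0 < - s \<or> 0 < - p \<or> 0 < q) \<longleftrightarrow> (r < 0 \<or> - s < 0 \<or> - p < 0 \<or> q < 0)"
    using pos by (intro sum_zero_signs) simp_all
  have "(e1 * a3) * s + (e2 * b2) * (- r) + (f2 * d1) * (- p) + (f1 * c2) * q = 0"
    using eq(6) by (simp add: mult_ac)
  then have 6: "(0 < s \<or> 0 < - r \<or> 0 < - p \<or> 0 < q) \<longleftrightarrow> (s < 0 \<or> - r < 0 \<or> - p < 0 \<or> q < 0)"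
    using pos by (intro sum_zero_signs) simp_all
  show ?thesis using 1 2 3 4 5 6 nz by (smt (verit))
qed

context edge_forms
begin

text \<open>The line through \<open>mid i\<close> and \<open>mid j\<close> leaves the polygon
  exactly at these two points. The vertices on the two arcs between the edges \<open>i\<close> and
  \<open>j\<close> therefore lie on opposite sides of it, and so do \<open>mid k\<close> and
  \<open>mid l\<close>.\<close>

lemma crossing:
  assumes ij: "i < j" "j < n" and k: "i < k" "k < j" and l: "l < n" "l < i \<or> j < l"
  obtains c t where "0 < c" "c < 1" "0 < t" "t < 1"
    "(1 - c) *\<^sub>R homog (mid i) + c *\<^sub>R homog (mid j) = (1 - t) *\<^sub>R homog (mid k) + t *\<^sub>R homog (mid l)"
proof -
  define g where "g x = cross2 (mid j - mid i) (x - mid i)" for x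
  have g_comb: "g (u *\<^sub>R x + v *\<^sub>R y) = u * g x + v * g y" if "u + v = 1" for u v x y
  proof -
    have u: "u = 1 - v" using that by simp
    show ?thesis unfolding u by (simp add: g_def cross2_def algebra_simps)
  qed
  have i: "i < n" using ij by simp
  have d: "mid j - mid i \<noteq> 0"
    using F_mid[of i] F_mid_pos[of j i] ij by auto
  have line: "\<exists>c. x = (1 - c) *\<^sub>R mid i + c *\<^sub>R mid j" if gx: "g x = 0" for x
  proof -
    obtain c where "x - mid i = c *\<^sub>R (mid j - mid i)"
      by (rule cross2_eq_0[OF gx[unfolded g_def] d])
    then have x: "x = c *\<^sub>R (mid j - mid i) + mid i" by (simp only: diff_eq_eq)
    show ?thesis unfolding x by (intro exI[of _ c]) (simp add: algebra_simps)
  qed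
  \<comment> \<open>A point of the polygon on the line lies between \<open>mid i\<close> and
    \<open>mid j\<close>, by the signs of \<open>F i\<close> and \<open>F j\<close>; there every
    other form is positive.\<close>
  have off: False
    if x: "x \<in> polygon_region n P" "g x = 0" "F e \<bullet> homog x = 0" and e: "e < n" "e \<noteq> i" "e \<noteq> j" for x e
  proof -
    obtain c where xc: "x = (1 - c) *\<^sub>R mid i + c *\<^sub>R mid j" using line x by blast
    have hx: "homog x = (1 - c) *\<^sub>R homog (mid i) + c *\<^sub>R homog (mid j)"
      unfolding xc by (rule homog_affine) simp
    have "0 \<le> c * (F i \<bullet> homog (mid j))"
      using F_nonneg[OF i x(1)] F_mid[OF i] by (simp add: hx inner_add_right)
    then have "0 \<le> c" using F_mid_pos[of j i] ij by (simp add: zero_le_mult_iff)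
    have "0 \<le> (1 - c) * (F j \<bullet> homog (mid i))"
      using F_nonneg[OF ij(2) x(1)] F_mid[OF ij(2)] by (simp add: hx inner_add_right)
    then have "c \<le> 1" using F_mid_pos[of i j] ij by (simp add: zero_le_mult_iff)
    have pos: "0 < F e \<bullet> homog (mid i)" "0 < F e \<bullet> homog (mid j)"
      using F_mid_pos e ij by auto
    have "(1 - c) * (F e \<bullet> homog (mid i)) + c * (F e \<bullet> homog (mid j)) = 0"
      using x(3) by (simp add: hx inner_add_right)
    moreover have "0 \<le> (1 - c) * (F e \<bullet> homog (mid i))" "0 \<le> c * (F e \<bullet> homog (mid j))"
      using pos \<open>0 \<le> c\<close> \<open>c \<le> 1\<close> by simp_all
    ultimately have "(1 - c) * (F e \<bullet> homog (mid i)) = 0" "c * (F e \<bullet> homog (mid j)) = 0"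
      by linarith+
    then show False using pos by simp
  qed
  have same: "0 < g (P e) * g (P (Suc e mod n))" if e: "e < n" "e \<noteq> i" "e \<noteq> j" for e
  proof (rule ccontr)
    assume neg: "\<not> ?thesis"
    show False
    proof (cases "g (P e) = g (P (Suc e mod n))")
      case True
      then have "g (P e) = 0" using neg by (auto simp: not_less mult_le_0_iff)
      then show False using off[of "P e" e] F_left e by auto
    next
      case False
      obtain t where t: "0 \<le> t" "t \<le> 1" "(1 - t) * g (P e) + t * g (P (Suc e mod n)) = 0"
        using affine_zero[of "g (P e)" "g (P (Suc e mod n))"] neg False by auto
      define x where "x = (1 - t) *\<^sub>R P e + t *\<^sub>R P (Suc e mod n)"
      have "homog x = (1 - t) *\<^sub>R homog (P e) + t *\<^sub>R homog (P (Suc e mod n))"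
        unfolding x_def by (rule homog_affine) simp
      then have "F e \<bullet> homog x = 0" using F_left F_right e by (simp add: inner_add_right)
      moreover have "x \<in> polygon_region n P"
        unfolding x_def polygon_region_def using t e
        by (intro convexD[OF convex_convex_hull]) (auto intro: hull_inc)
      moreover have "g x = 0" unfolding x_def using t by (subst g_comb) auto
      ultimately show False using off e by blast
    qed
  qed
  \<comment> \<open>The line passes through the midpoint of edge \<open>e\<close>, so the values at
    its ends cancel; if they were zero, the whole edge would collapse to its midpoint.\<close>
  have opp: "g (P (Suc e mod n)) = - g (P e) \<and> g (P e) \<noteq> 0" if e: "e = i \<or> e = j" for e
  proof -
    have en: "e < n" using e ij by auto
    have ge: "g (mid e) = 0" using e by (auto simp: g_def cross2_def)
    then have "(1/2) * g (P e) + (1/2) * g (P (Suc e mod n)) = 0"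
      unfolding mid_def by (subst (asm) g_comb) auto
    moreover have "g (P e) \<noteq> 0"
    proof
      assume "g (P e) = 0"
      then obtain c where c: "P e = (1 - c) *\<^sub>R mid i + c *\<^sub>R mid j" using line by blast
      have "homog (P e) = (1 - c) *\<^sub>R homog (mid i) + c *\<^sub>R homog (mid j)"
        unfolding c by (rule homog_affine) simp
      then have "(1 - c) * (F e \<bullet> homog (mid i)) + c * (F e \<bullet> homog (mid j)) = 0"
        using F_left[OF en] by (simp add: inner_add_right)
      then have "P e = mid e"
        using e c F_mid[OF i] F_mid[OF ij(2)] F_mid_pos[of i j] F_mid_pos[of j i] ij by auto
      then have "(1/2) *\<^sub>R P e = (1/2) *\<^sub>R P (Suc e mod n)"
        unfolding mid_def by (metis add_diff_cancel_left' scaleR_half_double scaleR_right_distrib)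
      then have "P e = P (Suc e mod n)" by simp
      then show False using inj_P en Suc_mod_neq[OF en] by (auto simp: inj_on_def)
    qed
    ultimately show ?thesis by simp
  qed
  \<comment> \<open>Multiplying by \<sigma> fixes the sign: the arc from \<open>Suc i\<close> to
    \<open>j\<close> becomes positive and its complement negative.\<close>
  define \<sigma> where "\<sigma> = g (P (Suc i))"
  have s0: "\<sigma> * g (P i) < 0" "\<sigma> \<noteq> 0"
    using opp[of i] ij by (auto simp: \<sigma>_def zero_less_mult_iff mult_less_0_iff)
  have same_sign: "0 < \<sigma> * g (P e) \<longleftrightarrow> 0 < \<sigma> * g (P (Suc e mod n))"
    "\<sigma> * g (P e) < 0 \<longleftrightarrow> \<sigma> * g (P (Suc e mod n)) < 0" if "e < n" "e \<noteq> i" "e \<noteq> j" for e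
    using same[OF that] by (auto simp: zero_less_mult_iff mult_less_0_iff)
  have arc1: "0 < \<sigma> * g (P v)" if "Suc i \<le> v" "v \<le> j" for v
    using that
  proof (induction v rule: dec_induct)
    case base
    then show ?case using s0 by (simp add: \<sigma>_def) (meson linorder_neq_iff mult_neg_neg mult_pos_pos)
  next
    case (step v)
    then show ?case using step(1-4) same_sign(1)[of v] ij by simp
  qed
  have arc2: "\<sigma> * g (P v) < 0" if "v \<le> i" for v
    using that
  proof (induction v rule: inc_induct)
    case (step v)
    then show ?case using step(1-3) same_sign(2)[of v] ij by simp
  qed (rule s0)
  have arc3: "\<sigma> * g (P v) < 0" if "Suc j \<le> v" "v < n" for v
    using that
  proof (induction v rule: dec_induct)
    case base
    then show ?case using opp[of j] arc1[of j] ij by (simp add: zero_less_mult_iff mult_less_0_iff)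
  next
    case (step v)
    then show ?case using step(1-4) same_sign(2)[of v] ij by simp
  qed
  have half: "g (mid e) = (g (P e) + g (P (Suc e mod n))) / 2" for e
    unfolding mid_def by (subst g_comb) auto
  have "0 < \<sigma> * g (P k)" "0 < \<sigma> * g (P (Suc k))"
    using arc1[of k] arc1[of "Suc k"] k by auto
  then have gk: "0 < \<sigma> * g (mid k)"
    using k ij by (simp add: half algebra_simps)
  \<comment> \<open>For \<open>l = n - 1\<close> the successor wraps around to vertex 0, which
    belongs to the arc of vertices up to \<open>i\<close>.\<close>
  have "\<sigma> * g (P l) < 0" "\<sigma> * g (P (Suc l mod n)) < 0"
    using l arc2[of l] arc3[of l] arc2[of "Suc l mod n"] arc3[of "Suc l mod n"] ij
    by (auto simp: mod_Suc)
  then have gl: "\<sigma> * g (mid l) < 0" by (simp add: half algebra_simps)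
  have "g (mid k) * g (mid l) \<le> 0" "g (mid k) \<noteq> g (mid l)"
    using gk gl by (auto simp: zero_less_mult_iff mult_less_0_iff mult_le_0_iff)
  then obtain t where t: "(1 - t) * g (mid k) + t * g (mid l) = 0" "0 \<le> t" "t \<le> 1"
    using affine_zero by metis
  then have "g ((1 - t) *\<^sub>R mid k + t *\<^sub>R mid l) = 0" by (subst g_comb) auto
  then obtain c where "(1 - t) *\<^sub>R mid k + t *\<^sub>R mid l = (1 - c) *\<^sub>R mid i + c *\<^sub>R mid j"
    using line by blast
  then have "homog ((1 - t) *\<^sub>R mid k + t *\<^sub>R mid l) = homog ((1 - c) *\<^sub>R mid i + c *\<^sub>R mid j)"
    by simp
  then have z: "(1 - c) *\<^sub>R homog (mid i) + c *\<^sub>R homog (mid j) = (1 - t) *\<^sub>R homog (mid k) + t *\<^sub>R homog (mid l)"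
    by (simp add: homog_affine)
  have zF: "(1 - c) * (F e \<bullet> homog (mid i)) + c * (F e \<bullet> homog (mid j)) = (1 - t) * (F e \<bullet> homog (mid k)) + t * (F e \<bullet> homog (mid l))" for e
    using arg_cong[OF z, of "\<lambda>v. F e \<bullet> v"] by (simp add: inner_add_right)
  \<comment> \<open>Evaluating the edge forms at the crossing point shows that it is none of the
    four midpoints.\<close>
  have conv: "0 < (1 - t) * a + t * b" if "0 < a" "0 < b" for a b :: real
    using t that by (cases "t = 0") (auto intro!: add_nonneg_pos)
  have "0 < (1 - t) * (F i \<bullet> homog (mid k)) + t * (F i \<bullet> homog (mid l))"
    using F_mid_pos ij k l by (intro conv) auto
  then have "0 < c * (F i \<bullet> homog (mid j))" using zF[of i] F_mid[OF i] by simp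
  then have c0: "0 < c" using F_mid_pos[of j i] ij by (simp add: zero_less_mult_iff)
  have "0 < (1 - t) * (F j \<bullet> homog (mid k)) + t * (F j \<bullet> homog (mid l))"
    using F_mid_pos ij k l by (intro conv) auto
  then have "0 < (1 - c) * (F j \<bullet> homog (mid i))" using zF[of j] F_mid[OF ij(2)] by simp
  then have c1: "c < 1" using F_mid_pos[of i j] ij by (simp add: zero_less_mult_iff)
  have "0 < (1 - c) * (F k \<bullet> homog (mid i)) + c * (F k \<bullet> homog (mid j))"
    using F_mid_pos ij k l c0 c1 by (intro add_pos_pos mult_pos_pos) auto
  then have "t \<noteq> 0" using zF[of k] F_mid[of k] ij k by auto
  have "0 < (1 - c) * (F l \<bullet> homog (mid i)) + c * (F l \<bullet> homog (mid j))"
    using F_mid_pos ij k l c0 c1 by (intro add_pos_pos mult_pos_pos) auto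
  then have "t \<noteq> 1" using zF[of l] F_mid[of l] l by auto
  show ?thesis using that[OF c0 c1 _ _ z] t \<open>t \<noteq> 0\<close> \<open>t \<noteq> 1\<close> by simp
qed

text \<open>In the dependency between the four forms the edges \<open>i\<close>, \<open>j\<close>
  have one sign and \<open>k\<close>, \<open>l\<close> the other. Pairing it with \<open>b\<close>
  gives a sum of terms of equal sign that is zero, so three forms vanish on \<open>b\<close>.
  Applied to the difference of two scaled points, this forbids ties that cross.\<close>

lemma no_cross:
  assumes ij: "i < j" "j < n" and k: "i < k" "k < j" and l: "l < n" "l < i \<or> j < l"
    and b: "0 \<le> F i \<bullet> b" "0 \<le> F j \<bullet> b" "F k \<bullet> b \<le> 0" "F l \<bullet> b \<le> 0"
  shows "b = 0"
proof -
  obtain c t where ct: "0 < c" "c < 1" "0 < t" "t < 1"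
    and z: "(1 - c) *\<^sub>R homog (mid i) + c *\<^sub>R homog (mid j) = (1 - t) *\<^sub>R homog (mid k) + t *\<^sub>R homog (mid l)"
    using crossing[OF ij k l] by metis
  obtain p q r s where rel: "p *\<^sub>R F i + q *\<^sub>R F j + r *\<^sub>R F k + s *\<^sub>R F l = 0"
    and nz: "p \<noteq> 0 \<or> q \<noteq> 0 \<or> r \<noteq> 0 \<or> s \<noteq> 0"
    by (rule plane_dependent)
  have ev: "p * (F i \<bullet> x) + q * (F j \<bullet> x) + r * (F k \<bullet> x) + s * (F l \<bullet> x) = 0" for x
    using arg_cong[OF rel, of "\<lambda>v. v \<bullet> x"] by (simp add: inner_add_left)
  have lt: "i < n" "k < n" using ij k by auto
  define V where "V e f = F e \<bullet> homog (mid f)" for e f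
  have V0: "V e e = 0" if "e < n" for e using F_mid that by (simp add: V_def)
  have E1: "q * V j i + r * V k i + s * V l i = 0"
    using ev[of "homog (mid i)"] V0[of i] lt by (simp add: V_def)
  have E2: "p * V i j + r * V k j + s * V l j = 0"
    using ev[of "homog (mid j)"] V0[of j] ij by (simp add: V_def)
  have E3: "p * V i k + q * V j k + s * V l k = 0"
    using ev[of "homog (mid k)"] V0[of k] lt by (simp add: V_def)
  have E4: "p * V i l + q * V j l + r * V k l = 0"
    using ev[of "homog (mid l)"] V0[of l] l by (simp add: V_def)
  have zV: "(1 - c) * V e i + c * V e j = (1 - t) * V e k + t * V e l" for e
    using arg_cong[OF z, of "\<lambda>v. F e \<bullet> v"] by (simp add: V_def inner_add_right)
  \<comment> \<open>Apply \<open>p *\<^sub>R F i + r *\<^sub>R F k\<close> to the two expressions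
    for the crossing point and eliminate by \<open>E2\<close> and \<open>E4\<close>;
    \<open>X2\<close> does the same with \<open>F l\<close> in place of \<open>F k\<close>.\<close>
  have X1: "(1 - c) * (r * V k i) - c * (s * V l j) = (1 - t) * (p * V i k) - t * (q * V j l)"
  proof -
    have "p * ((1 - c) * V i i + c * V i j) + r * ((1 - c) * V k i + c * V k j) =
        p * ((1 - t) * V i k + t * V i l) + r * ((1 - t) * V k k + t * V k l)"
      by (simp only: zV)
    then have "(1 - c) * (r * V k i) + c * (p * V i j + r * V k j) =
        (1 - t) * (p * V i k) + t * (p * V i l + r * V k l)"
      using V0 lt by (simp add: algebra_simps)
    moreover have "p * V i j + r * V k j = - (s * V l j)" "p * V i l + r * V k l = - (q * V j l)"
      using E2 E4 by linarith+
    ultimately show ?thesis by simp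
  qed
  have X2: "(1 - c) * (s * V l i) - c * (r * V k j) = t * (p * V i l) - (1 - t) * (q * V j k)"
  proof -
    have "p * ((1 - c) * V i i + c * V i j) + s * ((1 - c) * V l i + c * V l j) =
        p * ((1 - t) * V i k + t * V i l) + s * ((1 - t) * V l k + t * V l l)"
      by (simp only: zV)
    then have "(1 - c) * (s * V l i) + c * (p * V i j + s * V l j) =
        t * (p * V i l) + (1 - t) * (p * V i k + s * V l k)"
      using V0 lt l by (simp add: algebra_simps)
    moreover have "p * V i j + s * V l j = - (r * V k j)" "p * V i k + s * V l k = - (q * V j k)"
      using E2 E3 by linarith+
    ultimately show ?thesis by simp
  qed
  have Vpos: "0 < V e f" if "e < n" "f < n" "e \<noteq> f" for e f
    using F_mid_pos that by (simp add: V_def)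
  have signs: "(0 < p \<and> 0 < q \<and> r < 0 \<and> s < 0) \<or> (p < 0 \<and> q < 0 \<and> 0 < r \<and> 0 < s)"
    by (rule crossing_signs[OF _ _ _ _ _ _ _ _ _ _ _ _ _ _ _ _ E1 E2 E3 E4 X1 X2 nz])
      (use ct Vpos ij k l in auto)
  have *: "F i \<bullet> b = 0 \<and> F j \<bullet> b = 0 \<and> F k \<bullet> b = 0"
    if "0 < p'" "0 < q'" "0 < r'" "0 < s'"
      and "p' * (F i \<bullet> b) + q' * (F j \<bullet> b) - r' * (F k \<bullet> b) - s' * (F l \<bullet> b) = 0" for p' q' r' s'
  proof -
    have "0 \<le> p' * (F i \<bullet> b)" "0 \<le> q' * (F j \<bullet> b)" "r' * (F k \<bullet> b) \<le> 0" "s' * (F l \<bullet> b) \<le> 0"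
      using that b by (auto simp: mult_le_0_iff)
    then have "p' * (F i \<bullet> b) = 0" "q' * (F j \<bullet> b) = 0" "r' * (F k \<bullet> b) = 0"
      using that by linarith+
    then show ?thesis using that by simp
  qed
  have "F i \<bullet> b = 0 \<and> F j \<bullet> b = 0 \<and> F k \<bullet> b = 0"
    using signs *[of p q "-r" "-s"] *[of "-p" "-q" r s] ev[of b] by auto
  then show ?thesis
    using F_separate[of i j k b] ij k by simp
qed

end

section \<open>Cycles of ties\<close>

locale tied_forms = edge_forms +
  fixes m :: nat and A :: "nat \<Rightarrow> real^2"
  assumes A_pos: "\<lbrakk>k < m; i < n\<rbrakk> \<Longrightarrow> 0 < F i \<bullet> homog (A k)"
    and A_in: "k < m \<Longrightarrow> A k \<in> polygon_region n P"
    and inj_A: "inj_on A {..<m}"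
    and general_plus: "general_plus_position (P ` {..<n} \<union> A ` {..<m})"
begin

definition low :: "nat \<Rightarrow> real" where
  "low k = Min ((\<lambda>i. F i \<bullet> homog (A k)) ` {..<n})"

text \<open>Normalised so that the least form has the value 1 at every point. The difference of two
  scaled points tied to the same edge is then annihilated by the form of that edge.\<close>

definition scaled :: "nat \<Rightarrow> (real^2) \<times> real" where
  "scaled k = (1 / low k) *\<^sub>R homog (A k)"

definition ties :: "nat \<Rightarrow> nat set" where
  "ties k = {i. i < n \<and> F i \<bullet> scaled k = 1}"

lemma low_le: "i < n \<Longrightarrow> low k \<le> F i \<bullet> homog (A k)"
  unfolding low_def by (intro Min_le) auto

lemma low_attained: obtains i where "i < n" "low k = F i \<bullet> homog (A k)"
proof -
  have "low k \<in> (\<lambda>i. F i \<bullet> homog (A k)) ` {..<n}"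
    unfolding low_def using n3 by (intro Min_in) (auto simp: lessThan_empty_iff)
  then show ?thesis using that by auto
qed

lemma low_pos: "k < m \<Longrightarrow> 0 < low k"
  using low_attained[of k] A_pos by metis

lemma scaled_ge: "k < m \<Longrightarrow> i < n \<Longrightarrow> 1 \<le> F i \<bullet> scaled k"
  using low_le low_pos by (simp add: scaled_def field_simps)

lemma ties_iff: "k < m \<Longrightarrow> i \<in> ties k \<longleftrightarrow> i < n \<and> F i \<bullet> homog (A k) = low k"
  using low_pos[of k] by (auto simp: ties_def scaled_def)

lemma A_ne_P: "k < m \<Longrightarrow> v < n \<Longrightarrow> A k \<noteq> P v"
  using A_pos[of k v] F_left[of v] by auto

lemma scaled_inj:
  assumes "scaled k = scaled l" "k < m" "l < m"
  shows "k = l"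
proof -
  have "low k = low l" using assms(1) by (simp add: scaled_def homog_def)
  with assms low_pos[of l] have "A k = A l" by (simp add: scaled_def homog_def)
  then show ?thesis using inj_A assms by (auto simp: inj_on_def)
qed

text \<open>Dividing by \<open>c\<close> would express the vertex as an affine combination of
  \<open>A k\<close> and \<open>A l\<close>, against general position; \<open>c = 0\<close> would
  make the two points equal.\<close>

lemma scaled_diff_not_vertex:
  assumes "k < m" "l < m" "k \<noteq> l" "v < n"
  shows "scaled k - scaled l \<noteq> c *\<^sub>R homog (P v)"
proof
  assume eq: "scaled k - scaled l = c *\<^sub>R homog (P v)"
  define x y where "x = 1 / low k" and "y = 1 / low l"
  have e: "x *\<^sub>R A k - y *\<^sub>R A l = c *\<^sub>R P v" "x - y = c"
    using eq by (simp_all add: scaled_def homog_def x_def y_def)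
  have Akl: "A k \<noteq> A l" using inj_A assms by (auto simp: inj_on_def)
  have "c \<noteq> 0"
  proof
    assume "c = 0"
    then have "scaled k = scaled l" using eq by simp
    then show False using scaled_inj assms by blast
  qed
  have "P v = (1 / c) *\<^sub>R (c *\<^sub>R P v)" using \<open>c \<noteq> 0\<close> by simp
  also have "\<dots> = (x / c) *\<^sub>R A k + (- y / c) *\<^sub>R A l"
    by (simp add: e(1)[symmetric] scaleR_diff_right)
  finally have "P v = (x / c) *\<^sub>R A k + (- y / c) *\<^sub>R A l" .
  moreover have "x / c + (- y / c) = 1"
    using e(2) \<open>c \<noteq> 0\<close> by (simp flip: diff_divide_distrib)
  ultimately have "P v \<in> affine hull {A k, A l}" unfolding affine_hull_2 by blast
  then have "collinear {A k, A l, P v}"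
    using Akl collinear_3_affine_hull by blast
  moreover have "distinct [A k, A l, P v]"
    using Akl A_ne_P assms by auto
  ultimately show False
    using general_plus assms unfolding general_plus_position_def general_position_def by blast
qed

text \<open>The forms \<open>dual_left i\<close> and \<open>dual_right i\<close> are dual to the end points of edge \<open>i\<close>, so that
  \<open>interp h i\<close> interpolates \<open>h\<close> along edge \<open>i\<close>.\<close>

definition dual_right :: "nat \<Rightarrow> (real^2) \<times> real" where
  "dual_right i = (let e = P (Suc i mod n) - P i in ((1 / (e \<bullet> e)) *\<^sub>R e, - (e \<bullet> P i) / (e \<bullet> e)))"

definition dual_left :: "nat \<Rightarrow> (real^2) \<times> real" where
  "dual_left i = (0, 1) - dual_right i"

definition interp :: "(nat \<Rightarrow> real) \<Rightarrow> nat \<Rightarrow> (real^2) \<times> real" where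
  "interp h i = h i *\<^sub>R dual_left i + h (Suc i mod n) *\<^sub>R dual_right i"

lemma dual:
  assumes "i < n"
  shows "dual_left i \<bullet> homog (P i) = 1" "dual_left i \<bullet> homog (P (Suc i mod n)) = 0"
    "dual_right i \<bullet> homog (P i) = 0" "dual_right i \<bullet> homog (P (Suc i mod n)) = 1"
proof -
  define e where "e = P (Suc i mod n) - P i"
  have "e \<noteq> 0" using inj_P assms Suc_mod_neq[OF assms] by (auto simp: inj_on_def e_def)
  then have e: "e \<bullet> e \<noteq> 0" by simp
  have P': "P (Suc i mod n) = P i + e" by (simp add: e_def)
  show "dual_right i \<bullet> homog (P i) = 0" "dual_right i \<bullet> homog (P (Suc i mod n)) = 1"
    using e unfolding dual_right_def Let_def e_def[symmetric] homog_def
    by (simp_all add: P' inner_add_right add_divide_distrib)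
  then show "dual_left i \<bullet> homog (P i) = 1" "dual_left i \<bullet> homog (P (Suc i mod n)) = 0"
    by (simp_all add: dual_left_def inner_diff_left, simp_all add: homog_def)
qed

lemma interp_left: "i < n \<Longrightarrow> interp h i \<bullet> homog (P i) = h i"
  by (simp add: interp_def inner_add_left dual)

lemma interp_right: "i < n \<Longrightarrow> interp h i \<bullet> homog (P (Suc i mod n)) = h (Suc i mod n)"
  by (simp add: interp_def inner_add_left dual)

lemma edge_coords:
  assumes "i < n" "F i \<bullet> b = 0"
  shows "b = (dual_left i \<bullet> b) *\<^sub>R homog (P i) + (dual_right i \<bullet> b) *\<^sub>R homog (P (Suc i mod n))"
proof -
  obtain p q where b: "b = p *\<^sub>R homog (P i) + q *\<^sub>R homog (P (Suc i mod n))"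
    using edge_decompose[OF assms] by metis
  have "dual_left i \<bullet> b = p" "dual_right i \<bullet> b = q"
    unfolding b using assms(1) by (simp_all add: inner_add_right dual)
  then show ?thesis using b by simp
qed

lemma interp_unit:
  "interp (\<lambda>w. of_bool (w = v)) i \<bullet> b =
     of_bool (i = v) * (dual_left i \<bullet> b) + of_bool (Suc i mod n = v) * (dual_right i \<bullet> b)"
  by (simp add: interp_def inner_add_left)

section \<open>From cycles of ties to concurrent lines\<close>

text \<open>The vector \<open>q\<close> represents a point, possibly at infinity, on every line
  joining \<open>P (\<omega> j)\<close> to \<open>A (\<kappa> j)\<close>.\<close>

lemma not_concurrent:
  fixes \<kappa> \<omega> :: "nat \<Rightarrow> nat"
  assumes \<kappa>: "\<And>j. \<kappa> j < m" "distinct [\<kappa> 0, \<kappa> 1, \<kappa> 2]"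
    and \<omega>: "\<And>j. \<omega> j < n" "distinct [\<omega> 0, \<omega> 1, \<omega> 2]" "\<And>v. v < n \<Longrightarrow> \<exists>j. v = \<omega> j"
    and q: "\<And>j. scaled (\<kappa> j) = q + c j *\<^sub>R homog (P (\<omega> j))"
  shows False
proof -
  obtain q1 t where qt: "q = (q1, t)" by fastforce
  have e1: "(1 / low (\<kappa> j)) *\<^sub>R A (\<kappa> j) = q1 + c j *\<^sub>R P (\<omega> j)"
    and e2: "1 / low (\<kappa> j) = t + c j" for j
    using arg_cong[OF q[of j], of fst] arg_cong[OF q[of j], of snd]
    by (simp_all add: scaled_def homog_def qt)
  show False
  proof (cases "t = 0")
    case False
    \<comment> \<open>For nonzero last coordinate \<open>t\<close> the lines meet in the finite
      point \<open>(1 / t) *\<^sub>R q1\<close>.\<close>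
    have "(1 / t) *\<^sub>R q1 \<in> affine hull {P (\<omega> j), A (\<kappa> j)}" for j
    proof -
      have "(1 / t) *\<^sub>R q1 = (1 / t) *\<^sub>R ((1 / low (\<kappa> j)) *\<^sub>R A (\<kappa> j) - c j *\<^sub>R P (\<omega> j))"
        by (simp only: e1) simp
      also have "\<dots> = (- c j / t) *\<^sub>R P (\<omega> j) + (1 / low (\<kappa> j) / t) *\<^sub>R A (\<kappa> j)"
        by (simp add: scaleR_diff_right)
      finally have "(1 / t) *\<^sub>R q1 = (- c j / t) *\<^sub>R P (\<omega> j) + (1 / low (\<kappa> j) / t) *\<^sub>R A (\<kappa> j)" .
      moreover have "- c j / t + 1 / low (\<kappa> j) / t = 1"
        unfolding e2 using False by (simp add: field_simps)
      ultimately show ?thesis unfolding affine_hull_2 by blast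
    qed
    then have "affine hull {P (\<omega> 0), A (\<kappa> 0)} \<inter> affine hull {P (\<omega> 1), A (\<kappa> 1)}
        \<inter> affine hull {P (\<omega> 2), A (\<kappa> 2)} \<noteq> {}" by blast
    moreover have "distinct [P (\<omega> 0), A (\<kappa> 0), P (\<omega> 1), A (\<kappa> 1), P (\<omega> 2), A (\<kappa> 2)]"
    proof -
      have "P (\<omega> i) = P (\<omega> j) \<longleftrightarrow> \<omega> i = \<omega> j" "A (\<kappa> i) = A (\<kappa> j) \<longleftrightarrow> \<kappa> i = \<kappa> j" for i j
        using inj_P inj_A \<kappa>(1) \<omega>(1) by (auto simp: inj_on_def)
      moreover have "A (\<kappa> i) \<noteq> P (\<omega> j)" "P (\<omega> j) \<noteq> A (\<kappa> i)" for i j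
        using A_ne_P[OF \<kappa>(1) \<omega>(1)] by metis+
      ultimately show ?thesis using \<kappa>(2) \<omega>(2) by simp
    qed
    moreover have "P (\<omega> j) \<in> P ` {..<n} \<union> A ` {..<m}" "A (\<kappa> j) \<in> P ` {..<n} \<union> A ` {..<m}" for j
      using \<kappa>(1) \<omega>(1) by auto
    ultimately show False
      using general_plus[unfolded general_plus_position_def, THEN conjunct2, rule_format,
          of "P (\<omega> 0)" "A (\<kappa> 0)" "P (\<omega> 1)" "A (\<kappa> 1)" "P (\<omega> 2)" "A (\<kappa> 2)"] by metis
  next
    case True
    \<comment> \<open>At infinity, each point arises from its vertex by a positive shift along
      \<open>q1\<close>. Starting from the vertex that is extreme in this direction, the shift
      leaves the polygon.\<close>
    have A_eq: "A (\<kappa> j) = P (\<omega> j) + low (\<kappa> j) *\<^sub>R q1" for j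
    proof -
      have l: "low (\<kappa> j) \<noteq> 0" using low_pos[OF \<kappa>(1)[of j]] by simp
      have "A (\<kappa> j) = low (\<kappa> j) *\<^sub>R ((1 / low (\<kappa> j)) *\<^sub>R A (\<kappa> j))" using l by simp
      also have "\<dots> = low (\<kappa> j) *\<^sub>R q1 + (low (\<kappa> j) * c j) *\<^sub>R P (\<omega> j)"
        by (simp only: e1 scaleR_add_right scaleR_scaleR)
      also have "low (\<kappa> j) * c j = 1" using e2[of j] True l by (simp add: field_simps)
      finally show ?thesis by simp
    qed
    have "q1 \<noteq> 0" using A_eq[of 0] A_ne_P[OF \<kappa>(1)[of 0] \<omega>(1)[of 0]] by auto
    obtain v where v: "v < n" "\<And>w. w < n \<Longrightarrow> q1 \<bullet> P w \<le> q1 \<bullet> P v"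
    proof -
      have "Max ((\<lambda>w. q1 \<bullet> P w) ` {..<n}) \<in> (\<lambda>w. q1 \<bullet> P w) ` {..<n}"
        using n3 by (intro Max_in) (auto simp: lessThan_empty_iff)
      then obtain v where "v < n" "q1 \<bullet> P v = Max ((\<lambda>w. q1 \<bullet> P w) ` {..<n})" by auto
      then show ?thesis by (intro that[of v]) (auto intro: Max_ge)
    qed
    obtain j where j: "v = \<omega> j" using \<omega>(3) v(1) by blast
    have "polygon_region n P \<subseteq> {x. q1 \<bullet> x \<le> q1 \<bullet> P v}"
      unfolding polygon_region_def
      by (rule hull_minimal) (use v in \<open>auto simp: convex_halfspace_le\<close>)
    then have "q1 \<bullet> A (\<kappa> j) \<le> q1 \<bullet> P v" using A_in[OF \<kappa>(1)] by blast
    then have "low (\<kappa> j) * (q1 \<bullet> q1) \<le> 0" by (simp add: A_eq[of j] j inner_add_right)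
    moreover have "0 < q1 \<bullet> q1" using \<open>q1 \<noteq> 0\<close> by simp
    ultimately show False using low_pos[OF \<kappa>(1)[of j]] by (auto simp: mult_le_0_iff)
  qed
qed

text \<open>The exchange cycle is continued periodically to all indices. The hypothesis
  \<open>zero\<close> says that its cost vanishes for every \<open>h\<close>, tested on the unit
  vectors.\<close>

lemma tie_cycle_contradiction:
  fixes \<kappa> \<rho> :: "nat \<Rightarrow> nat"
  assumes r: "2 \<le> r"
    and \<kappa>: "\<And>i j. \<kappa> i = \<kappa> j \<longleftrightarrow> i mod r = j mod r" "\<And>j. \<kappa> j < m"
    and \<rho>: "\<And>i j. \<rho> i = \<rho> j \<longleftrightarrow> i mod r = j mod r"
    and ties: "\<And>j. \<rho> j \<in> ties (\<kappa> j)" "\<And>j. \<rho> (Suc j) \<in> ties (\<kappa> j)"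
    and zero: "\<And>v. v < n \<Longrightarrow> (\<Sum>j<r. interp (\<lambda>w. of_bool (w = v)) (\<rho> (Suc j)) \<bullet> scaled (\<kappa> j)
        - interp (\<lambda>w. of_bool (w = v)) (\<rho> j) \<bullet> scaled (\<kappa> j)) = 0"
  shows False
proof -
  have \<rho>n: "\<rho> j < n" for j using ties(1) by (auto simp: ties_def)
  have F1: "F (\<rho> j) \<bullet> scaled (\<kappa> j) = 1" "F (\<rho> (Suc j)) \<bullet> scaled (\<kappa> j) = 1" for j
    using ties by (auto simp: ties_def)
  have Suc_mod: "Suc i mod r = Suc j mod r \<longleftrightarrow> i mod r = j mod r" for i j
  proof -
    have "i mod r < r" "j mod r < r" using r by simp_all
    then show ?thesis by (auto simp: mod_Suc split: if_splits)
  qed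
  have \<rho>Suc: "\<rho> (Suc i) = \<rho> (Suc j) \<longleftrightarrow> i mod r = j mod r" for i j
    by (simp add: \<rho> Suc_mod)
  have mod_window: "i = j" if "i mod r = j mod r" "i \<le> j" "j < i + r" for i j
  proof -
    have "r dvd j - i" using that mod_eq_dvd_iff_nat[of i j r] by simp
    then show ?thesis using that by (metis add.commute dvd_imp_le le_antisym less_diff_conv2 linorder_not_less zero_less_diff)
  qed
  \<comment> \<open>Both points are tied to edge \<open>\<rho> (Suc j)\<close>, so
    \<open>d j\<close> is a combination of the ends of that edge, with coefficients
    \<open>al j\<close> and \<open>be j\<close>. By general position neither coefficient
    vanishes.\<close>
  define d where "d j = scaled (\<kappa> j) - scaled (\<kappa> (Suc j))" for j
  define al where "al j = dual_left (\<rho> (Suc j)) \<bullet> d j" for j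
  define be where "be j = dual_right (\<rho> (Suc j)) \<bullet> d j" for j
  have dc: "d j = al j *\<^sub>R homog (P (\<rho> (Suc j))) + be j *\<^sub>R homog (P (Suc (\<rho> (Suc j)) mod n))" for j
    unfolding al_def be_def
    by (rule edge_coords[OF \<rho>n]) (simp add: d_def inner_diff_right F1)
  have per: "al i = al j \<and> be i = be j" if "i mod r = j mod r" for i j
  proof -
    have "\<rho> (Suc i) = \<rho> (Suc j)" "\<kappa> i = \<kappa> j" "\<kappa> (Suc i) = \<kappa> (Suc j)"
      using that by (simp_all add: \<rho>Suc \<kappa> Suc_mod)
    then show ?thesis by (simp add: al_def be_def d_def)
  qed
  have \<kappa>S: "\<kappa> j \<noteq> \<kappa> (Suc j)" for j
    using mod_window[of j "Suc j"] r by (auto simp: \<kappa>(1))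
  have al0: "al j \<noteq> 0" for j
    using dc[of j] scaled_diff_not_vertex[OF \<kappa>(2) \<kappa>(2) \<kappa>S Suc_mod_less] by (auto simp: d_def)
  have be0: "be j \<noteq> 0" for j
    using dc[of j] scaled_diff_not_vertex[OF \<kappa>(2) \<kappa>(2) \<kappa>S \<rho>n] by (auto simp: d_def)
  \<comment> \<open>A balance at each vertex \<open>v\<close> between the edge starting there and
    the edge ending there. It arises from \<open>zero\<close> by shifting the subtracted terms by
    one index, which collects the two points tied to the same edge.\<close>
  have flow: "(\<Sum>j<r. of_bool (\<rho> (Suc j) = v) * al j) + (\<Sum>j<r. of_bool (Suc (\<rho> (Suc j)) mod n = v) * be j) = 0"
    if "v < n" for v
  proof -
    let ?L = "interp (\<lambda>w. of_bool (w = v))"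
    define f where "f j = ?L (\<rho> j) \<bullet> scaled (\<kappa> j)" for j
    have "\<rho> r = \<rho> 0" "\<kappa> r = \<kappa> 0" using \<rho>[of r 0] \<kappa>(1)[of r 0] by simp_all
    then have "f r = f 0" by (simp add: f_def)
    then have "(\<Sum>j<r. f j) = (\<Sum>j<r. f (Suc j))"
      using sum.lessThan_Suc_shift[of f r] by simp
    then have "(\<Sum>j<r. ?L (\<rho> (Suc j)) \<bullet> d j) = 0"
      using zero[OF that] by (simp add: d_def f_def inner_diff_right sum_subtractf)
    then show ?thesis by (simp add: interp_unit al_def be_def sum.distrib)
  qed
  have only: "(\<Sum>j<r. of_bool (Q j) * g j) = g i" if "i < r" "\<And>j. j < r \<Longrightarrow> Q j \<longleftrightarrow> j = i" for Q i and g :: "nat \<Rightarrow> real"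
  proof -
    have "(\<Sum>j<r. of_bool (Q j) * g j) = (\<Sum>j<r. if j = i then g j else 0)"
      using that by (intro sum.cong) auto
    then show ?thesis using that by simp
  qed
  \<comment> \<open>Exactly one edge of the cycle starts at this vertex, with nonzero
    \<open>al\<close>, so the balance needs an edge of the cycle ending there.\<close>
  have pred: "\<exists>j'. Suc (\<rho> (Suc j')) mod n = \<rho> (Suc j) \<and> be j' = - al j" for j
  proof -
    define i where "i = j mod r"
    have i: "i < r" "i mod r = j mod r" using r by (simp_all add: i_def)
    have "(\<Sum>j'<r. of_bool (\<rho> (Suc j') = \<rho> (Suc j)) * al j') = al i"
      using i by (intro only) (auto simp: \<rho>Suc)
    then have sum: "(\<Sum>j'<r. of_bool (Suc (\<rho> (Suc j')) mod n = \<rho> (Suc j)) * be j') = - al j"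
      using flow[OF \<rho>n[of "Suc j"]] per[OF i(2)] by simp
    have "\<exists>j'<r. Suc (\<rho> (Suc j')) mod n = \<rho> (Suc j)"
    proof (rule ccontr)
      assume "\<not> ?thesis"
      then have "(\<Sum>j'<r. of_bool (Suc (\<rho> (Suc j')) mod n = \<rho> (Suc j)) * be j') = 0"
        by (intro sum.neutral) auto
      then show False using sum al0[of j] by simp
    qed
    then obtain j' where j': "j' < r" "Suc (\<rho> (Suc j')) mod n = \<rho> (Suc j)" by blast
    have "(\<Sum>k<r. of_bool (Suc (\<rho> (Suc k)) mod n = \<rho> (Suc j)) * be k) = be j'"
      using j' \<rho>n by (intro only) (auto simp flip: j'(2) simp: Suc_mod_inj \<rho>Suc)
    then show ?thesis using j' sum by auto
  qed
  have prev: "\<rho> j = \<rho> (Suc (j + r - 1))" for j using r by (simp add: \<rho>)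
  \<comment> \<open>The set of edges on the cycle is closed under cyclic predecessors: descend to 0,
    wrap around to \<open>n - 1\<close>, and descend again.\<close>
  have all: "\<exists>j. v = \<rho> j" if "v < n" for v
  proof -
    have hit_pred: "\<exists>j. v = \<rho> j" if ex: "\<exists>j. Suc v mod n = \<rho> j" and v: "v < n" for v
    proof -
      obtain j where j: "Suc v mod n = \<rho> j" using ex by blast
      obtain j' where "Suc (\<rho> (Suc j')) mod n = \<rho> j" using pred prev by metis
      then show ?thesis using j Suc_mod_inj v \<rho>n by metis
    qed
    have down: "\<exists>j. v = \<rho> j" if "v \<le> w" "w < n" "\<exists>j. w = \<rho> j" for v w
      using that(1)
    proof (induction v rule: inc_induct)
      case (step u)
      then show ?case using hit_pred[of u] that(2) by simp
    qed (rule that(3))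
    obtain j0 where "\<rho> j0 = 0" using down[of 0 "\<rho> 0"] \<rho>n by fastforce
    then have "Suc (n - 1) mod n = \<rho> j0" using n3 by simp
    then have ex: "\<exists>j. Suc (n - 1) mod n = \<rho> j" by (rule exI)
    have n1: "n - 1 < n" using n3 by simp
    have "v \<le> n - 1" using that by simp
    then show ?thesis by (rule down[OF _ n1 hit_pred[OF ex n1]])
  qed
  have r3: "3 \<le> r"
  proof -
    have "{..<n} \<subseteq> \<rho> ` {..<r}"
    proof
      fix v assume "v \<in> {..<n}"
      then obtain j where "v = \<rho> j" using all by auto
      then have "v = \<rho> (j mod r)" using r by (simp add: \<rho>)
      then show "v \<in> \<rho> ` {..<r}" using r by auto
    qed
    then have "card {..<n} \<le> card {..<r}" by (meson card_image_le card_mono finite_imageI finite_lessThan le_trans)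
    then show ?thesis using n3 by simp
  qed
  \<comment> \<open>Otherwise the two edges separate the others into two nonempty arcs. The rest of
    the cycle visits both, so at some index \<open>t\<close> it jumps between them, and the ties of
    \<open>\<kappa> t\<close> cross those of \<open>\<kappa> j\<close>.\<close>
  have adj: "Suc (\<rho> j) mod n = \<rho> (Suc j) \<or> Suc (\<rho> (Suc j)) mod n = \<rho> j" for j
  proof (rule ccontr)
    assume nadj: "\<not> ?thesis"
    define i i' where "i = min (\<rho> j) (\<rho> (Suc j))" and "i' = max (\<rho> j) (\<rho> (Suc j))"
    have "\<rho> j \<noteq> \<rho> (Suc j)" using mod_window[of j "Suc j"] r by (auto simp: \<rho>)
    then have ii: "i < i'" "i' < n" "i = \<rho> j \<and> i' = \<rho> (Suc j) \<or> i = \<rho> (Suc j) \<and> i' = \<rho> j"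
      using \<rho>n by (auto simp: i_def i'_def)
    have "Suc i mod n \<noteq> i'" "Suc i' mod n \<noteq> i" using nadj ii(3) by auto
    moreover have "Suc i' mod n = 0" if "i' = n - 1" using that n3 by simp
    ultimately have nadj': "Suc i \<noteq> i'" "\<not> (i = 0 \<and> i' = n - 1)" using ii(2) by auto
    have window: "\<exists>t. j + 2 \<le> t \<and> t < j + r \<and> \<rho> t = v" if v: "v < n" "v \<noteq> i" "v \<noteq> i'" for v
    proof -
      obtain s where s: "v = \<rho> s" using all v by blast
      \<comment> \<open>The index congruent to \<open>s\<close> in the window of length
        \<open>r\<close> from \<open>j\<close>; adding \<open>r * j\<close> keeps the subtraction
        from truncating.\<close>
      define t where "t = j + (s + r * j - j) mod r"
      have "j \<le> r * j" using r by simp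
      then have "j + (s + r * j - j) = s + r * j" by (intro le_add_diff_inverse trans_le_add2)
      then have "t mod r = s mod r" unfolding t_def mod_add_right_eq by simp
      then have "\<rho> t = v" by (simp add: s \<rho>)
      moreover have "j \<le> t" "t < j + r" using r by (simp_all add: t_def)
      moreover have "t \<noteq> j" "t \<noteq> Suc j" using \<open>\<rho> t = v\<close> v ii by auto
      ultimately show ?thesis by (intro exI[of _ t]) auto
    qed
    have notin: "\<rho> t \<noteq> i \<and> \<rho> t \<noteq> i'" if "j + 2 \<le> t" "t < j + r" for t
      using mod_window[of j t] mod_window[of "Suc j" t] that ii by (auto simp: \<rho>)
    define Q where "Q t \<longleftrightarrow> i < \<rho> t \<and> \<rho> t < i'" for t
    obtain t1 where t1: "j + 2 \<le> t1" "t1 < j + r" "Q t1"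
      using window[of "Suc i"] ii nadj' by (auto simp: Q_def)
    obtain t2 where t2: "j + 2 \<le> t2" "t2 < j + r" "\<not> Q t2"
    proof (cases "i = 0")
      case False
      then show ?thesis using window[of 0] ii that by (fastforce simp: Q_def)
    next
      case True
      then show ?thesis using window[of "n - 1"] ii nadj' that by (fastforce simp: Q_def)
    qed
    have "\<exists>t. j + 2 \<le> t \<and> Suc t < j + r \<and> Q t \<noteq> Q (Suc t)"
    proof (rule ccontr)
      assume no: "\<not> ?thesis"
      have "Q t = Q (j + 2)" if "j + 2 \<le> t" "t < j + r" for t
        using that
      proof (induction t rule: dec_induct)
        case (step t)
        then show ?case using no by (metis Suc_lessD)
      qed simp
      then show False using t1 t2 by blast
    qed
    then obtain t where t: "j + 2 \<le> t" "Suc t < j + r" "Q t \<noteq> Q (Suc t)" by blast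
    \<comment> \<open>A scaled point has the value 1 at its own ties and at least 1 at every edge,
      which gives \<open>b\<close> weakly opposite signs on the two pairs of edges.\<close>
    define b where "b = scaled (\<kappa> t) - scaled (\<kappa> j)"
    have bi: "0 \<le> F i \<bullet> b" "0 \<le> F i' \<bullet> b"
      using ii F1[of j] scaled_ge[OF \<kappa>(2)[of t] \<rho>n[of j]] scaled_ge[OF \<kappa>(2)[of t] \<rho>n[of "Suc j"]]
      by (auto simp: b_def inner_diff_right)
    have bt: "F (\<rho> t) \<bullet> b \<le> 0" "F (\<rho> (Suc t)) \<bullet> b \<le> 0"
      using F1[of t] scaled_ge[OF \<kappa>(2)[of j] \<rho>n[of t]] scaled_ge[OF \<kappa>(2)[of j] \<rho>n[of "Suc t"]]
      by (auto simp: b_def inner_diff_right)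
    have ni: "\<rho> t \<noteq> i \<and> \<rho> t \<noteq> i'" "\<rho> (Suc t) \<noteq> i \<and> \<rho> (Suc t) \<noteq> i'"
      using notin t by auto
    have "b = 0"
    proof (cases "Q t")
      case True
      then show ?thesis
        using no_cross[OF ii(1,2), of "\<rho> t" "\<rho> (Suc t)" b] t(3) ni \<rho>n bi bt by (auto simp: Q_def)
    next
      case False
      then show ?thesis
        using no_cross[OF ii(1,2), of "\<rho> (Suc t)" "\<rho> t" b] t(3) ni \<rho>n bi bt by (auto simp: Q_def)
    qed
    then have "\<kappa> t = \<kappa> j" using scaled_inj \<kappa>(2) by (simp add: b_def)
    then have "t mod r = j mod r" by (simp add: \<kappa>(1))
    then show False using mod_window[of j t] t by auto
  qed
  \<comment> \<open>The cycle cannot turn back, so its first step decides whether it runs forwards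
    or backwards along the boundary.\<close>
  have skip: "\<rho> (Suc (Suc j)) \<noteq> \<rho> j" for j
    using mod_window[of j "Suc (Suc j)"] r3 by (auto simp: \<rho>)
  have mods: "0 mod r \<noteq> 1 mod r" "0 mod r \<noteq> 2 mod r" "1 mod r \<noteq> 2 mod r"
    using mod_window[of 0 1] mod_window[of 0 2] mod_window[of 1 2] r3 by linarith+
  have dist: "distinct [\<kappa> 0, \<kappa> 1, \<kappa> 2]" "distinct [\<rho> 0, \<rho> 1, \<rho> 2]"
    "distinct [\<rho> (Suc 0), \<rho> (Suc 1), \<rho> (Suc 2)]"
    using mods
    by (simp_all only: distinct.simps list.set insert_iff empty_iff \<kappa>(1) \<rho>Suc simp_thms)
      (simp only: \<rho> simp_thms)
  show False
  proof (cases "Suc (\<rho> 0) mod n = \<rho> (Suc 0)")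
    case True
    have up: "Suc (\<rho> j) mod n = \<rho> (Suc j)" for j
    proof (induction j)
      case (Suc j)
      then show ?case using adj[of "Suc j"] skip[of j] Suc_mod_inj \<rho>n by metis
    qed (rule True)
    have ab: "be j = - al (Suc j)" for j
    proof -
      obtain j' where j': "Suc (\<rho> (Suc j')) mod n = \<rho> (Suc (Suc j))" "be j' = - al (Suc j)"
        using pred by blast
      then have "\<rho> (Suc j') = \<rho> (Suc j)" using up[of "Suc j"] Suc_mod_inj \<rho>n by metis
      then show ?thesis using j' per \<rho>Suc by metis
    qed
    \<comment> \<open>By the balance, consecutive differences telescope, so \<open>q j\<close> does
      not depend on \<open>j\<close> and represents the common point of the lines.\<close>
    define q where "q j = scaled (\<kappa> j) - al j *\<^sub>R homog (P (\<rho> (Suc j)))" for j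
    have "q (Suc j) = q j" for j
      using dc[of j] by (simp add: q_def d_def ab up algebra_simps)
    then have "q j = q 0" for j by (induction j) auto
    then have "scaled (\<kappa> j) = q 0 + al j *\<^sub>R homog (P (\<rho> (Suc j)))" for j
      by (metis q_def diff_add_cancel)
    moreover have "\<exists>j. v = \<rho> (Suc j)" if "v < n" for v
      using all[OF that] prev by metis
    ultimately show False
      using not_concurrent[of \<kappa> "\<lambda>j. \<rho> (Suc j)" "q 0" al] \<kappa>(2) dist \<rho>n by blast
  next
    case False
    have down: "Suc (\<rho> (Suc j)) mod n = \<rho> j" for j
    proof (induction j)
      case 0
      then show ?case using False adj[of 0] by auto
    next
      case (Suc j)
      then show ?case using adj[of "Suc j"] skip[of j] by metis
    qed
    have ab: "be (Suc j) = - al j" for j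
    proof -
      obtain j' where j': "Suc (\<rho> (Suc j')) mod n = \<rho> (Suc j)" "be j' = - al j"
        using pred by blast
      then have "\<rho> (Suc j') = \<rho> (Suc (Suc j))" using down[of "Suc j"] Suc_mod_inj \<rho>n by metis
      then show ?thesis using j' per \<rho>Suc by metis
    qed
    \<comment> \<open>For the backward direction \<open>al\<close> and \<open>be\<close> exchange
      their roles.\<close>
    define q where "q j = scaled (\<kappa> j) - be j *\<^sub>R homog (P (\<rho> j))" for j
    have "q (Suc j) = q j" for j
      using dc[of j] by (simp add: q_def d_def ab down algebra_simps)
    then have "q j = q 0" for j by (induction j) auto
    then have "scaled (\<kappa> j) = q 0 + be j *\<^sub>R homog (P (\<rho> j))" for j
      by (metis q_def diff_add_cancel)
    then show False
      using not_concurrent[of \<kappa> \<rho> "q 0" be] \<kappa>(2) dist \<rho>n all by blast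
  qed
qed

end

section \<open>Construction of the subdivision\<close>

text \<open>A side is a face of a polytope, hence exposed by a supporting line. Another vertex on it
  would be an extreme point of the segment, that is, one of its ends; and a proper face misses the
  interior.\<close>

lemma convex_polygon_edge_forms:
  assumes "convex_polygon n P"
  obtains F where "edge_forms n P F"
    and "\<And>i x. \<lbrakk>i < n; x \<in> interior (polygon_region n P)\<rbrakk> \<Longrightarrow> 0 < F i \<bullet> homog x"
proof -
  let ?S = "polygon_region n P"
  have n3: "3 \<le> n" and inj: "inj_on P {..<n}"
    and ext: "\<And>v. v < n \<Longrightarrow> P v extreme_point_of ?S"
    and face: "\<And>i. i < n \<Longrightarrow> polygon_side n P i face_of ?S"
    using assms by (auto simp: convex_polygon_def edge_of_def)
  have "polyhedron ?S"
    unfolding polygon_region_def by (intro polyhedron_convex_hull) simp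
  then have "\<exists>a b. ?S \<subseteq> {x. a \<bullet> x \<le> b} \<and> polygon_side n P i = ?S \<inter> {x. a \<bullet> x = b}" if "i < n" for i
    using face[OF that] exposed_face_of_polyhedron[of ?S] by (auto simp: exposed_face_of_def)
  then obtain a b where ab: "\<And>i. i < n \<Longrightarrow> ?S \<subseteq> {x. a i \<bullet> x \<le> b i}"
    "\<And>i. i < n \<Longrightarrow> polygon_side n P i = ?S \<inter> {x. a i \<bullet> x = b i}"
    by metis
  define F where "F i = (- a i, b i)" for i
  have F: "F i \<bullet> homog x = b i - a i \<bullet> x" for i x by (simp add: F_def homog_def)
  have ends: "P i \<in> polygon_side n P i" "P (Suc i mod n) \<in> polygon_side n P i" for i
    by (simp_all add: polygon_side_def)
  have off: "P v \<notin> polygon_side n P i" if "i < n" "v < n" "v \<noteq> i" "v \<noteq> Suc i mod n" for i v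
  proof
    assume "P v \<in> polygon_side n P i"
    then have "P v extreme_point_of polygon_side n P i"
      using extreme_point_of_face[OF face[OF that(1)]] ext[OF that(2)] by blast
    then have "P v = P i \<or> P v = P (Suc i mod n)"
      by (simp add: polygon_side_def extreme_point_of_segment)
    then show False using inj that by (auto simp: inj_on_def)
  qed
  have PS: "P v \<in> ?S" if "v < n" for v
    using that unfolding polygon_region_def by (intro hull_inc) auto
  show ?thesis
  proof (rule that[of F])
    show "edge_forms n P F"
    proof
      fix i assume i: "i < n"
      show "F i \<bullet> homog (P i) = 0" "F i \<bullet> homog (P (Suc i mod n)) = 0"
        using ends[of i] ab(2)[OF i] by (auto simp: F)
    next
      fix i v assume iv: "i < n" "v < n" "v \<noteq> i" "v \<noteq> Suc i mod n"
      then have "a i \<bullet> P v \<noteq> b i" using off ab(2) PS by blast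
      moreover have "a i \<bullet> P v \<le> b i" using ab(1) PS iv by blast
      ultimately show "0 < F i \<bullet> homog (P v)" by (simp add: F)
    qed (rule n3)
  next
    fix i x assume i: "i < n" and x: "x \<in> interior ?S"
    obtain v where v: "v < n" "v \<noteq> i" "v \<noteq> Suc i mod n"
    proof -
      have "card {i, Suc i mod n} < card {..<n}"
        using n3 by (simp add: card_insert_if)
      then have "\<not> {..<n} \<subseteq> {i, Suc i mod n}"
        by (meson card_mono finite.emptyI finite.insertI linorder_not_less)
      then show ?thesis using that by auto
    qed
    have "polygon_side n P i \<noteq> ?S" using off[OF i v] PS[OF v(1)] by auto
    then have "x \<notin> polygon_side n P i"
      using face_of_disjoint_interior[OF face[OF i]] x by blast
    moreover have "x \<in> ?S" using x interior_subset by blast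
    ultimately have "a i \<bullet> x \<noteq> b i" "a i \<bullet> x \<le> b i" using ab[OF i] by blast+
    then show "0 < F i \<bullet> homog x" by (simp add: F)
  qed
qed

text \<open>Otherwise some \<open>H\<close> annihilates all vertices. A dependency between the first
  three vertices and \<open>H\<close> is then trivial, as testing with \<open>H\<close>,
  \<open>F 0\<close> and \<open>F 1\<close> shows, although four vectors are always
  dependent.\<close>

lemma (in edge_forms) interior_nonempty: "interior (polygon_region n P) \<noteq> {}"
proof
  assume "interior (polygon_region n P) = {}"
  then obtain a b where a: "a \<noteq> 0" "polygon_region n P \<subseteq> {x. a \<bullet> x = b}"
    using empty_interior_subset_hyperplane[of "polygon_region n P"]
    by (auto simp: polygon_region_def)
  define H where "H = (a, - b)"
  have H: "H \<bullet> homog (P v) = 0" if "v < n" for v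
    using a(2) vertex_in[OF that] by (auto simp: H_def homog_def)
  obtain p q r s where rel: "p *\<^sub>R homog (P 0) + q *\<^sub>R homog (P 1) + r *\<^sub>R homog (P 2) + s *\<^sub>R H = 0"
    and nz: "p \<noteq> 0 \<or> q \<noteq> 0 \<or> r \<noteq> 0 \<or> s \<noteq> 0"
    by (rule plane_dependent)
  have ev: "p * (y \<bullet> homog (P 0)) + q * (y \<bullet> homog (P 1)) + r * (y \<bullet> homog (P 2)) + s * (y \<bullet> H) = 0" for y
    using arg_cong[OF rel, of "\<lambda>x. y \<bullet> x"] by (simp add: inner_add_right)
  have "H \<noteq> 0" using a(1) by (simp add: H_def zero_prod_def)
  then have s: "s = 0" using ev[of H] H n3 by simp
  have "0 < F 0 \<bullet> homog (P 2)" "0 < F 1 \<bullet> homog (P 0)"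
    using n3 by (auto intro!: F_pos simp: mod_Suc)
  moreover have "F 0 \<bullet> homog (P 0) = 0" "F 0 \<bullet> homog (P 1) = 0"
    "F 1 \<bullet> homog (P 1) = 0" "F 1 \<bullet> homog (P 2) = 0"
    using F_left[of 0] F_right[of 0] F_left[of 1] F_right[of 1] n3 by (simp_all add: numeral_2_eq_2)
  ultimately have "r = 0" "p = 0" using ev[of "F 0"] ev[of "F 1"] s by auto
  then show False using rel s nz by (simp add: homog_def zero_prod_def)
qed

section \<open>The regions on which one form is minimal\<close>

lemma subdivision_from_forms:
  fixes n :: nat and P :: "nat \<Rightarrow> real^2" and G :: "nat \<Rightarrow> (real^2) \<times> real"
  assumes poly: "convex_polygon n P"
    and eq: "\<And>i. i < n \<Longrightarrow> G i \<bullet> homog (P (Suc i mod n)) = G (Suc i mod n) \<bullet> homog (P (Suc i mod n))"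
    and less: "\<And>i v. \<lbrakk>i < n; v < n; v \<noteq> i; v \<noteq> Suc i mod n\<rbrakk> \<Longrightarrow> G v \<bullet> homog (P v) < G i \<bullet> homog (P v)"
    and A_inj: "inj_on A {..<m}" and A_int: "A ` {..<m} \<subseteq> interior (polygon_region n P)"
    and M: "\<And>k. k < m \<Longrightarrow> M k < n"
    and A_less: "\<And>k i. \<lbrakk>k < m; i < n; i \<noteq> M k\<rbrakk> \<Longrightarrow> G (M k) \<bullet> homog (A k) < G i \<bullet> homog (A k)"
  obtains R where "subdivides n R (polygon_region n P)"
    and "\<And>i. i < n \<Longrightarrow> convex (R i) \<and> polygon_side n P i edge_of R i \<and>
           A ` {..<m} \<inter> frontier (R i) = {} \<and>
           card (A ` {..<m} \<inter> interior (R i)) = card {k \<in> {..<m}. M k = i}"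
    and "\<And>i j. \<lbrakk>i < n; j < n; i \<noteq> j\<rbrakk> \<Longrightarrow> \<not> overlap (R i) (R j)"
proof -
  obtain F where "edge_forms n P F" using convex_polygon_edge_forms[OF poly] by metis
  then interpret edge_forms n P F .
  let ?S = "polygon_region n P"
  define R where "R i = {x \<in> ?S. \<forall>j<n. G i \<bullet> homog x \<le> G j \<bullet> homog x}" for i
  \<comment> \<open>The strict version is open and contained in \<open>R i\<close>. It witnesses
    nonempty interiors and contains the points assigned to \<open>i\<close>.\<close>
  define U where "U i = {x \<in> interior ?S. \<forall>j\<in>{..<n} - {i}. G i \<bullet> homog x < G j \<bullet> homog x}" for i
  have edge: "polygon_side n P i edge_of ?S" if "i < n" for i
    using poly that by (simp add: convex_polygon_def)
  have cS: "compact ?S" "convex ?S"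
    unfolding polygon_region_def by (auto intro: compact_convex_hull finite_imp_compact)
  have cont: "continuous_on UNIV (\<lambda>x. G i \<bullet> homog x)" for i
    by (intro continuous_intros)
  have closed: "closed (R i)" for i
  proof -
    have "R i = ?S \<inter> (\<Inter>j\<in>{..<n}. {x. G i \<bullet> homog x \<le> G j \<bullet> homog x})"
      by (auto simp: R_def)
    then show ?thesis
      using cS cont by (auto intro!: closed_Int closed_INT closed_Collect_le simp: compact_imp_closed)
  qed
  have convex: "convex (R i)" for i
  proof (rule convexI)
    fix x y and u v :: real
    assume xy: "x \<in> R i" "y \<in> R i" and uv: "0 \<le> u" "0 \<le> v" "u + v = 1"
    have "u * (G i \<bullet> homog x) + v * (G i \<bullet> homog y) \<le> u * (G j \<bullet> homog x) + v * (G j \<bullet> homog y)"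
      if "j < n" for j
      using xy uv that by (intro add_mono mult_left_mono) (auto simp: R_def)
    then show "u *\<^sub>R x + v *\<^sub>R y \<in> R i"
      using xy uv convexD[OF cS(2), of x y u v] by (auto simp: R_def homog_affine inner_add_right)
  qed
  have cover: "(\<Union>i<n. R i) = ?S"
  proof
    show "?S \<subseteq> (\<Union>i<n. R i)"
    proof
      fix x assume x: "x \<in> ?S"
      have "Min ((\<lambda>i. G i \<bullet> homog x) ` {..<n}) \<in> (\<lambda>i. G i \<bullet> homog x) ` {..<n}"
        using n3 by (intro Min_in) (auto simp: lessThan_empty_iff)
      then obtain i where i: "i < n" "G i \<bullet> homog x = Min ((\<lambda>i. G i \<bullet> homog x) ` {..<n})" by auto
      then have "x \<in> R i" using x by (auto simp: R_def intro!: Min_le)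
      then show "x \<in> (\<Union>i<n. R i)" using i by auto
    qed
  qed (auto simp: R_def)
  have U_open: "open (U i)" for i
  proof -
    have "U i = interior ?S \<inter> (\<Inter>j\<in>{..<n} - {i}. {x. G i \<bullet> homog x < G j \<bullet> homog x})"
      by (auto simp: U_def)
    then show ?thesis
      using cont by (auto intro!: open_Int open_INT open_Collect_less)
  qed
  have U_sub: "U i \<subseteq> interior (R i)" for i
  proof (rule interior_maximal[OF _ U_open])
    show "U i \<subseteq> R i"
    proof
      fix x assume x: "x \<in> U i"
      have "G i \<bullet> homog x \<le> G j \<bullet> homog x" if "j < n" for j
        using x that by (cases "j = i") (auto simp: U_def intro: less_imp_le)
      moreover have "x \<in> ?S" using x interior_subset by (auto simp: U_def)
      ultimately show "x \<in> R i" by (simp add: R_def)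
    qed
  qed
  have P_le: "G i \<bullet> homog (P i) \<le> G j \<bullet> homog (P i)"
    "G i \<bullet> homog (P (Suc i mod n)) \<le> G j \<bullet> homog (P (Suc i mod n))" if "i < n" "j < n" for i j
  proof -
    have *: "G v \<bullet> homog (P v) \<le> G j \<bullet> homog (P v)" if "v < n" for v
      using less[of j v] eq[of j] \<open>j < n\<close> that by (cases "v = j \<or> v = Suc j mod n") auto
    show "G i \<bullet> homog (P i) \<le> G j \<bullet> homog (P i)"
      "G i \<bullet> homog (P (Suc i mod n)) \<le> G j \<bullet> homog (P (Suc i mod n))"
      using *[OF that(1)] *[of "Suc i mod n"] eq[OF that(1)] by auto
  qed
  have side: "polygon_side n P i \<subseteq> R i" if "i < n" for i
    unfolding polygon_side_def
    by (rule closed_segment_subset[OF _ _ convex]) (use that P_le in \<open>auto simp: R_def\<close>)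
  have mid_less: "G i \<bullet> homog (mid i) < G j \<bullet> homog (mid i)" if ij: "i < n" "j < n" "j \<noteq> i" for i j
  proof -
    have "G i \<bullet> homog (P i) < G j \<bullet> homog (P i) \<or>
        G i \<bullet> homog (P (Suc i mod n)) < G j \<bullet> homog (P (Suc i mod n))"
    proof (cases "i = Suc j mod n")
      case True
      then have "Suc i mod n \<noteq> j" using Suc_Suc_mod_neq ij by auto
      moreover have "Suc i mod n \<noteq> Suc j mod n" using ij Suc_mod_inj by auto
      ultimately show ?thesis using less[of j "Suc i mod n"] eq[of i] ij by auto
    qed (use less ij in auto)
    then show ?thesis using P_le[OF ij(1,2)] by (auto simp: homog_mid inner_add_right)
  qed
  have U_ne: "U i \<noteq> {}" if i: "i < n" for i
  proof -
    have "open (\<Inter>j\<in>{..<n} - {i}. {x. G i \<bullet> homog x < G j \<bullet> homog x})" (is "open ?W")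
      using cont by (auto intro!: open_INT open_Collect_less)
    moreover have "mid i \<in> ?W" using mid_less i by auto
    \<comment> \<open>The midpoint lies on the boundary of the polygon, but its strict inequalities
      persist at nearby interior points.\<close>
    moreover have "mid i \<in> closure (interior ?S)"
      using convex_closure_interior[OF cS(2) interior_nonempty] mid_in[OF i] closure_subset by blast
    ultimately have "?W \<inter> interior ?S \<noteq> {}"
      using open_Int_closure_eq_empty by blast
    then show ?thesis by (auto simp: U_def)
  qed
  have own: "A k \<in> U (M k)" if "k < m" for k
    using that A_less A_int M by (auto simp: U_def)
  have other: "A k \<notin> R i" if "k < m" "i < n" "i \<noteq> M k" for k i
    using A_less[OF that] M[OF that(1)] by (auto simp: R_def not_le)
  show ?thesis
  proof (rule that[of R])
    show "subdivides n R ?S"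
      using cover closed U_ne U_sub unfolding subdivides_def by blast
  next
    fix i assume i: "i < n"
    have "polygon_side n P i edge_of R i"
      using edge[OF i] face_of_subset[of "polygon_side n P i" ?S "R i"] side[OF i]
      by (auto simp: edge_of_def R_def)
    moreover have "A k \<notin> frontier (R i)" if "k < m" for k
    proof (cases "i = M k")
      case True
      then show ?thesis using own[OF that] U_sub[of i] by (auto simp: frontier_def)
    next
      case False
      then show ?thesis using other[OF that i] frontier_subset_closed[OF closed] by blast
    qed
    moreover have "card (A ` {..<m} \<inter> interior (R i)) = card {k \<in> {..<m}. M k = i}"
    proof -
      have "A ` {..<m} \<inter> interior (R i) = A ` {k \<in> {..<m}. M k = i}"
        using own other[OF _ i] U_sub[of i] interior_subset[of "R i"] by blast
      then show ?thesis
        using card_image[OF inj_on_subset[OF A_inj], of "{k \<in> {..<m}. M k = i}"] by auto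
    qed
    ultimately show "convex (R i) \<and> polygon_side n P i edge_of R i \<and>
           A ` {..<m} \<inter> frontier (R i) = {} \<and>
           card (A ` {..<m} \<inter> interior (R i)) = card {k \<in> {..<m}. M k = i}"
      using convex by auto
  next
    fix i j assume ij: "i < n" "j < n" "i \<noteq> j"
    show "\<not> overlap (R i) (R j)"
    proof
      assume "overlap (R i) (R j)"
      then obtain x where "x \<in> interior (R i \<inter> R j)" by (auto simp: overlap_def)
      then obtain e where e: "0 < e" "ball x e \<subseteq> R i \<inter> R j"
        by (auto simp only: mem_interior)
      \<comment> \<open>Go from \<open>x\<close> slightly away from \<open>mid i\<close> to a point
        \<open>z\<close> still in both regions. The difference of \<open>G i\<close> and
        \<open>G j\<close> is zero at \<open>x\<close> and at most zero at \<open>z\<close>, hence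
        at least zero at \<open>mid i\<close>, against strict minimality of \<open>G i\<close>
        there.\<close>
      define y where "y = mid i"
      define t where "t = e / (2 * (norm (y - x) + 1))"
      have N: "0 < norm (y - x) + 1" using norm_ge_zero[of "y - x"] by linarith
      then have t: "0 < t" unfolding t_def using e(1) by simp
      have "t * norm (y - x) < t * (norm (y - x) + 1)" using t by simp
      also have "\<dots> = e / 2" unfolding t_def using N by (simp add: field_simps)
      also have "\<dots> < e" using e(1) by simp
      finally have "t * norm (y - x) < e" .
      define z where "z = (1 + t) *\<^sub>R x + (- t) *\<^sub>R y"
      have "x - z = t *\<^sub>R (y - x)" by (simp add: z_def algebra_simps)
      then have "dist x z = norm (t *\<^sub>R (y - x))" by (simp only: dist_norm)
      then have "z \<in> ball x e" using \<open>t * norm (y - x) < e\<close> t by simp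
      then have zR: "z \<in> R i" and xR: "x \<in> R i" "x \<in> R j" using e by auto
      have hz: "homog z = (1 + t) *\<^sub>R homog x + (- t) *\<^sub>R homog y"
        unfolding z_def by (rule homog_affine) simp
      have "G i \<bullet> homog x = G j \<bullet> homog x" using xR ij by (fastforce simp: R_def)
      moreover have "G i \<bullet> homog z \<le> G j \<bullet> homog z" using zR ij by (simp add: R_def)
      ultimately have "t * (G j \<bullet> homog y) \<le> t * (G i \<bullet> homog y)"
        by (simp add: hz inner_diff_right)
      then show False using mid_less[of i j] ij t by (simp add: y_def)
    qed
  qed
qed

section \<open>Choice of the multipliers\<close>

lemma assignment_with_counts:
  fixes c :: "nat \<Rightarrow> nat"
  assumes "(\<Sum>i<n. c i) = m"
  obtains M where "\<And>k. k < m \<Longrightarrow> M k < n" "\<And>i. i < n \<Longrightarrow> card {k \<in> {..<m}. M k = i} = c i"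
proof -
  have "card {..<m} = card (SIGMA i:{..<n}. {..<c i})" using assms by simp
  then obtain f where f: "bij_betw f {..<m} (SIGMA i:{..<n}. {..<c i})"
    using finite_same_card_bij[of "{..<m}" "SIGMA i:{..<n}. {..<c i}"] by auto
  show ?thesis
  proof (rule that[of "\<lambda>k. fst (f k)"])
    show "fst (f k) < n" if "k < m" for k
    proof -
      have "f k \<in> (SIGMA i:{..<n}. {..<c i})" using bij_betwE[OF f] that by auto
      then show ?thesis by auto
    qed
    show "card {k \<in> {..<m}. fst (f k) = i} = c i" if "i < n" for i
    proof -
      have "f ` {k \<in> {..<m}. fst (f k) = i} = {p \<in> f ` {..<m}. fst p = i}" by auto
      also have "\<dots> = {i} \<times> {..<c i}"
        using that by (auto simp: bij_betw_imp_surj_on[OF f])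
      finally have "f ` {k \<in> {..<m}. fst (f k) = i} = {i} \<times> {..<c i}" .
      moreover have "inj_on f {k \<in> {..<m}. fst (f k) = i}"
        using bij_betw_imp_inj_on[OF f] by (rule inj_on_subset) auto
      ultimately show ?thesis by (metis card_image card_cartesian_product_singleton card_lessThan)
    qed
  qed
qed

lemma (in edge_forms) scaled_edge_forms:
  assumes "\<And>i. 0 < s i"
  shows "edge_forms n P (\<lambda>i. s i *\<^sub>R F i)"
proof
  show "3 \<le> n" by (rule n3)
qed (simp_all add: F_left F_right F_pos assms)

text \<open>Optimal transport with the logarithmic cost; the rescaling exponentiates the dual potentials.\<close>

lemma (in edge_forms) rescaled_assignment:
  fixes m :: nat
  assumes A: "\<And>k i. \<lbrakk>k < m; i < n\<rbrakk> \<Longrightarrow> 0 < F i \<bullet> homog (A k)"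
    and M0: "\<And>k. k < m \<Longrightarrow> M0 k < n"
  obtains s M where "\<And>i. 0 < s i" "\<And>k. k < m \<Longrightarrow> M k < n"
    and "\<And>i. card {k \<in> {..<m}. M k = i} = card {k \<in> {..<m}. M0 k = i}"
    and "\<And>k i. \<lbrakk>k < m; i < n\<rbrakk> \<Longrightarrow> s (M k) *\<^sub>R F (M k) \<bullet> homog (A k) \<le> s i *\<^sub>R F i \<bullet> homog (A k)"
proof -
  define C where "C k i = ln (F i \<bullet> homog (A k))" for k i
  let ?T = "\<lambda>k::nat. {..<n}"
  have "\<forall>k\<in>{..<m}. ?T k \<subseteq> {..<n}" "\<forall>k\<in>{..<m}. M0 k \<in> ?T k" using M0 by auto
  from optimal_assignment[OF finite_lessThan finite_lessThan this, of C]
  obtain M where M: "\<forall>k\<in>{..<m}. M k \<in> ?T k"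
    "\<forall>i. card {k \<in> {..<m}. M k = i} = card {k \<in> {..<m}. M0 k = i}"
    and cyc: "\<forall>xs. exchange_cycle ?T {..<m} xs \<and> (\<forall>j<length xs. M (fst (xs ! j)) = snd (xs ! j)) \<longrightarrow>
       0 \<le> exchange_cost C xs"
    by (elim exE conjE)
  \<comment> \<open>The slack is zero because the optimum may have ties; they are resolved by the
    perturbation.\<close>
  obtain u where u: "\<And>k i. \<lbrakk>k \<in> {..<m}; i \<in> ?T k; i \<noteq> M k\<rbrakk> \<Longrightarrow> C k (M k) + u (M k) + 0 \<le> C k i + u i"
  proof (rule assignment_potentials[where T = ?T and K = "{..<m}" and I = "{..<n}" and M = M and \<eta> = 0 and C = C])
    show "real (length xs) * 0 \<le> exchange_cost C xs"
      if "exchange_cycle ?T {..<m} xs" "\<And>j. j < length xs \<Longrightarrow> M (fst (xs ! j)) = snd (xs ! j)" for xs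
      using cyc that by simp
  qed (use M in auto)
  have Mn: "M k < n" if "k < m" for k using M(1) that by auto
  show ?thesis
  proof (rule that[of "\<lambda>i. exp (u i)" M])
    fix k i assume k: "k < m" and i: "i < n"
    have e: "exp (C k j + u j) = exp (u j) *\<^sub>R F j \<bullet> homog (A k)" if "j < n" for j
      using A[OF k that] by (simp add: C_def exp_add)
    have "C k (M k) + u (M k) \<le> C k i + u i"
      using u[of k i] k i by (cases "i = M k") auto
    then have "exp (C k (M k) + u (M k)) \<le> exp (C k i + u i)" by simp
    then show "exp (u (M k)) *\<^sub>R F (M k) \<bullet> homog (A k) \<le> exp (u i) *\<^sub>R F i \<bullet> homog (A k)"
      unfolding e[OF Mn[OF k]] e[OF i] .
  qed (use M Mn in auto)
qed

section \<open>Breaking the ties by a generic perturbation\<close>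

text \<open>The cost of a fixed cycle is linear in \<open>h\<close>, with the costs for unit vectors
  as coefficients. With powers of \<open>t\<close> for \<open>h\<close> it becomes a polynomial in
  \<open>t\<close>.\<close>

lemma (in tied_forms) exchange_cost_interp:
  "exchange_cost (\<lambda>k i. interp h i \<bullet> scaled k) xs =
     (\<Sum>v<n. exchange_cost (\<lambda>k i. interp (\<lambda>w. of_bool (w = v)) i \<bullet> scaled k) xs * h v)"
  if "\<And>j. j < length xs \<Longrightarrow> snd (xs ! j) < n"
proof -
  have *: "interp h i \<bullet> b = (\<Sum>v<n. (interp (\<lambda>w. of_bool (w = v)) i \<bullet> b) * h v)" if "i < n" for i b
  proof -
    have "(\<Sum>v<n. (interp (\<lambda>w. of_bool (w = v)) i \<bullet> b) * h v) =
      (\<Sum>v<n. if v = i then h v * (dual_left i \<bullet> b) else 0) +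
      (\<Sum>v<n. if v = Suc i mod n then h v * (dual_right i \<bullet> b) else 0)"
      unfolding sum.distrib[symmetric] by (intro sum.cong) (auto simp: interp_unit algebra_simps)
    then show ?thesis using that by (simp add: interp_def inner_add_left)
  qed
  have "exchange_cost (\<lambda>k i. interp h i \<bullet> scaled k) xs =
    (\<Sum>j<length xs. \<Sum>v<n. (interp (\<lambda>w. of_bool (w = v)) (snd (xs ! (Suc j mod length xs))) \<bullet> scaled (fst (xs ! j))
       - interp (\<lambda>w. of_bool (w = v)) (snd (xs ! j)) \<bullet> scaled (fst (xs ! j))) * h v)"
    unfolding exchange_cost_def
  proof (rule sum.cong)
    fix j assume "j \<in> {..<length xs}"
    then have j: "j < length xs" "Suc j mod length xs < length xs" by (auto intro: mod_less_divisor)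
    show "interp h (snd (xs ! (Suc j mod length xs))) \<bullet> scaled (fst (xs ! j)) - interp h (snd (xs ! j)) \<bullet> scaled (fst (xs ! j)) =
     (\<Sum>v<n. (interp (\<lambda>w. of_bool (w = v)) (snd (xs ! (Suc j mod length xs))) \<bullet> scaled (fst (xs ! j))
       - interp (\<lambda>w. of_bool (w = v)) (snd (xs ! j)) \<bullet> scaled (fst (xs ! j))) * h v)"
      unfolding *[OF that[OF j(1)]] *[OF that[OF j(2)]] by (simp add: left_diff_distrib sum_subtractf)
  qed simp
  also have "\<dots> = (\<Sum>v<n. \<Sum>j<length xs. (interp (\<lambda>w. of_bool (w = v)) (snd (xs ! (Suc j mod length xs))) \<bullet> scaled (fst (xs ! j))
       - interp (\<lambda>w. of_bool (w = v)) (snd (xs ! j)) \<bullet> scaled (fst (xs ! j))) * h v)"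
    by (rule sum.swap)
  finally show ?thesis by (simp add: exchange_cost_def sum_distrib_right)
qed

lemma (in tied_forms) unit_cost_nonzero:
  assumes xs: "exchange_cycle ties {..<m} xs"
  shows "\<exists>v<n. exchange_cost (\<lambda>k i. interp (\<lambda>w. of_bool (w = v)) i \<bullet> scaled k) xs \<noteq> 0"
proof (rule ccontr)
  assume "\<not> ?thesis"
  then have zero: "exchange_cost (\<lambda>k i. interp (\<lambda>w. of_bool (w = v)) i \<bullet> scaled k) xs = 0" if "v < n" for v
    using that by blast
  define r where "r = length xs"
  define \<kappa> where "\<kappa> j = fst (xs ! (j mod r))" for j
  define \<rho> where "\<rho> j = snd (xs ! (j mod r))" for j
  have r: "2 \<le> r" using xs by (simp add: exchange_cycle_def r_def)
  then have jr: "j mod r < r" for j by simp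
  have d: "distinct (map fst xs)" "distinct (map snd xs)" using xs by (simp_all add: exchange_cycle_def)
  have x: "fst (xs ! j) < m" "snd (xs ! j) \<in> ties (fst (xs ! j))"
    "snd (xs ! (Suc j mod r)) \<in> ties (fst (xs ! j))" if "j < r" for j
    using xs that by (auto simp: exchange_cycle_def r_def)
  show False
  proof (rule tie_cycle_contradiction[OF r, of \<kappa> \<rho>])
    show "\<kappa> i = \<kappa> j \<longleftrightarrow> i mod r = j mod r" "\<rho> i = \<rho> j \<longleftrightarrow> i mod r = j mod r" for i j
      using nth_eq_iff_index_eq[OF d(1), of "i mod r" "j mod r"]
        nth_eq_iff_index_eq[OF d(2), of "i mod r" "j mod r"] jr
      by (auto simp: \<kappa>_def \<rho>_def r_def)
    show "\<kappa> j < m" "\<rho> j \<in> ties (\<kappa> j)" "\<rho> (Suc j) \<in> ties (\<kappa> j)" for j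
      using x[OF jr, of j] by (simp_all add: \<kappa>_def \<rho>_def mod_Suc_eq)
    show "(\<Sum>j<r. interp (\<lambda>w. of_bool (w = v)) (\<rho> (Suc j)) \<bullet> scaled (\<kappa> j)
        - interp (\<lambda>w. of_bool (w = v)) (\<rho> j) \<bullet> scaled (\<kappa> j)) = 0" if "v < n" for v
      using zero[OF that] unfolding exchange_cost_def r_def[symmetric]
      by (simp add: \<kappa>_def \<rho>_def)
  qed
qed

text \<open>A generic \<open>h\<close> is found on the moment curve, since a nonzero polynomial has finitely many
  roots.\<close>

lemma (in tied_forms) generic_interp:
  obtains h where "\<And>xs. exchange_cycle ties {..<m} xs \<Longrightarrow> exchange_cost (\<lambda>k i. interp h i \<bullet> scaled k) xs \<noteq> 0"
proof -
  define e where "e xs v = exchange_cost (\<lambda>k i. interp (\<lambda>w. of_bool (w = v)) i \<bullet> scaled k) xs" for xs v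
  define Z where "Z = {xs. exchange_cycle ties {..<m} xs}"
  have "finite Z"
    unfolding Z_def by (rule finite_exchange_cycles[of _ "{..<n}"]) (auto simp: ties_def)
  moreover have "finite {t :: real. (\<Sum>v\<le>n - 1. e xs v * t ^ v) = 0}" if xs: "xs \<in> Z" for xs
  proof -
    obtain v where "v < n" "e xs v \<noteq> 0"
      using unit_cost_nonzero[of xs] xs by (auto simp: Z_def e_def)
    then have "\<exists>v\<le>n - 1. e xs v \<noteq> 0" by (intro exI[of _ v]) auto
    then show ?thesis by (simp add: polyfun_finite_roots)
  qed
  ultimately have "finite (\<Union>xs\<in>Z. {t :: real. (\<Sum>v\<le>n - 1. e xs v * t ^ v) = 0})" by blast
  then obtain t :: real where t: "t \<notin> (\<Union>xs\<in>Z. {t. (\<Sum>v\<le>n - 1. e xs v * t ^ v) = 0})"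
    using ex_new_if_finite infinite_UNIV_char_0 by blast
  have *: "{..n - 1} = {..<n}" using n3 by auto
  show ?thesis
  proof (rule that[of "\<lambda>v. t ^ v"])
    fix xs assume xs: "exchange_cycle ties {..<m} xs"
    then have "snd (xs ! j) < n" if "j < length xs" for j
      using that by (auto simp: exchange_cycle_def ties_def)
    then show "exchange_cost (\<lambda>k i. interp (\<lambda>v. t ^ v) i \<bullet> scaled k) xs \<noteq> 0"
      using t xs unfolding * by (subst exchange_cost_interp) (auto simp: Z_def e_def)
  qed
qed

lemma eventually_perturbed_less:
  fixes a b a' b' :: real
  assumes "a < a'"
  shows "\<forall>\<^sub>F \<epsilon> in at_right 0. a + \<epsilon> * b < a' + \<epsilon> * b'"
proof -
  have "((\<lambda>\<epsilon>. a' + \<epsilon> * b' - (a + \<epsilon> * b)) \<longlongrightarrow> a' + 0 * b' - (a + 0 * b)) (at_right 0)"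
    by (intro tendsto_intros)
  then have "\<forall>\<^sub>F \<epsilon> in at_right 0. 0 < a' + \<epsilon> * b' - (a + \<epsilon> * b)"
    using assms by (auto dest!: order_tendstoD(1)[where a = 0])
  then show ?thesis by (rule eventually_mono) simp
qed

text \<open>Strict inequalities between the forms survive a small perturbation, and at ties the
  first-order term decides.\<close>

lemma (in tied_forms) perturbed_forms:
  assumes M0: "\<And>k. k < m \<Longrightarrow> M0 k \<in> ties k"
  obtains G M where
    "\<And>i. i < n \<Longrightarrow> G i \<bullet> homog (P (Suc i mod n)) = G (Suc i mod n) \<bullet> homog (P (Suc i mod n))"
    "\<And>i v. \<lbrakk>i < n; v < n; v \<noteq> i; v \<noteq> Suc i mod n\<rbrakk> \<Longrightarrow> G v \<bullet> homog (P v) < G i \<bullet> homog (P v)"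
    "\<And>k. k < m \<Longrightarrow> M k < n"
    "\<And>i. card {k \<in> {..<m}. M k = i} = card {k \<in> {..<m}. M0 k = i}"
    "\<And>k i. \<lbrakk>k < m; i < n; i \<noteq> M k\<rbrakk> \<Longrightarrow> G (M k) \<bullet> homog (A k) < G i \<bullet> homog (A k)"
proof -
  obtain h where h: "\<And>xs. exchange_cycle ties {..<m} xs \<Longrightarrow> exchange_cost (\<lambda>k i. interp h i \<bullet> scaled k) xs \<noteq> 0"
    using generic_interp by blast
  obtain M u where M: "\<And>k. k \<in> {..<m} \<Longrightarrow> M k \<in> ties k"
    "\<And>i. card {k \<in> {..<m}. M k = i} = card {k \<in> {..<m}. M0 k = i}"
    and u: "\<And>k i. \<lbrakk>k \<in> {..<m}; i \<in> ties k; i \<noteq> M k\<rbrakk> \<Longrightarrow>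
      interp h (M k) \<bullet> scaled k + u (M k) < interp h i \<bullet> scaled k + u i"
    by (rule strict_assignment[where T = ties and K = "{..<m}" and I = "{..<n}" and ?M0.0 = M0
          and C = "\<lambda>k i. interp h i \<bullet> scaled k"])
      (use M0 h in \<open>auto simp: ties_def\<close>)
  \<comment> \<open>On ties \<open>F i \<bullet> scaled k = 1\<close>, so the second summand
    contributes exactly the potential \<open>u i\<close>. It vanishes at the ends of edge
    \<open>i\<close>, so neighbouring forms still agree at their common vertex.\<close>
  define D where "D i = interp h i + u i *\<^sub>R F i" for i
  have Mn: "M k < n" "F (M k) \<bullet> scaled k = 1" if "k < m" for k
    using M(1) that by (auto simp: ties_def)
  have ev: "\<forall>\<^sub>F \<epsilon> in at_right 0. a \<bullet> x + \<epsilon> * (b \<bullet> x) < a' \<bullet> x + \<epsilon> * (b' \<bullet> x)"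
    if "a \<bullet> x < a' \<bullet> x" for a b a' b' x :: "(real^2) \<times> real"
    by (rule eventually_perturbed_less[OF that])
  have "\<forall>\<^sub>F \<epsilon> in at_right 0. 0 < \<epsilon> \<and>
    (\<forall>i\<in>{..<n}. \<forall>v\<in>{..<n} - {i, Suc i mod n}. (F v + \<epsilon> *\<^sub>R D v) \<bullet> homog (P v) < (F i + \<epsilon> *\<^sub>R D i) \<bullet> homog (P v)) \<and>
    (\<forall>k\<in>{..<m}. \<forall>i\<in>{..<n} - ties k. (F (M k) + \<epsilon> *\<^sub>R D (M k)) \<bullet> scaled k < (F i + \<epsilon> *\<^sub>R D i) \<bullet> scaled k)"
    unfolding inner_add_left inner_scaleR_left
  proof (intro eventually_conj eventually_ball_finite ballI ev)
    show "F v \<bullet> homog (P v) < F i \<bullet> homog (P v)" if "i \<in> {..<n}" "v \<in> {..<n} - {i, Suc i mod n}" for i v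
      using F_pos[of i v] F_left[of v] that by auto
    show "F (M k) \<bullet> scaled k < F i \<bullet> scaled k" if "k \<in> {..<m}" "i \<in> {..<n} - ties k" for i k
      using scaled_ge[of k i] Mn[of k] that by (auto simp: ties_def)
  qed (auto simp: eventually_at_right_less)
  then obtain \<epsilon> where \<epsilon>: "0 < \<epsilon>"
    "\<And>i v. \<lbrakk>i < n; v < n; v \<noteq> i; v \<noteq> Suc i mod n\<rbrakk> \<Longrightarrow> (F v + \<epsilon> *\<^sub>R D v) \<bullet> homog (P v) < (F i + \<epsilon> *\<^sub>R D i) \<bullet> homog (P v)"
    "\<And>k i. \<lbrakk>k < m; i < n; i \<notin> ties k\<rbrakk> \<Longrightarrow> (F (M k) + \<epsilon> *\<^sub>R D (M k)) \<bullet> scaled k < (F i + \<epsilon> *\<^sub>R D i) \<bullet> scaled k"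
    by (auto dest!: eventually_happens)
  define G where "G i = F i + \<epsilon> *\<^sub>R D i" for i
  show ?thesis
  proof (rule that[of G M])
    show "G i \<bullet> homog (P (Suc i mod n)) = G (Suc i mod n) \<bullet> homog (P (Suc i mod n))" if "i < n" for i
      using that by (simp add: G_def D_def inner_add_left F_left F_right interp_left interp_right)
    show "G v \<bullet> homog (P v) < G i \<bullet> homog (P v)" if "i < n" "v < n" "v \<noteq> i" "v \<noteq> Suc i mod n" for i v
      using \<epsilon>(2) that by (simp add: G_def)
    show "G (M k) \<bullet> homog (A k) < G i \<bullet> homog (A k)" if k: "k < m" "i < n" "i \<noteq> M k" for k i
    proof -
      have "G (M k) \<bullet> scaled k < G i \<bullet> scaled k"
      proof (cases "i \<in> ties k")
        case True
        then have "F i \<bullet> scaled k = 1" by (simp add: ties_def)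
        then show ?thesis
          using u[of k i] True k Mn[of k] \<epsilon>(1) by (simp add: G_def D_def inner_add_left)
      qed (use \<epsilon>(3) k in \<open>simp add: G_def\<close>)
      then show ?thesis using low_pos[OF k(1)] by (simp add: scaled_def divide_less_cancel)
    qed
  qed (use M Mn in auto)
qed

theorem theorem4:
  fixes n m :: nat and P A :: "nat \<Rightarrow> real^2" and c :: "nat \<Rightarrow> nat"
  assumes "convex_polygon n P"
    and "inj_on A {..<m}"
    and "A ` {..<m} \<subseteq> interior (polygon_region n P)"
    and "general_plus_position (P ` {..<n} \<union> A ` {..<m})"
    and "(\<Sum>i<n. c i) = m"
  shows "\<exists>R :: nat \<Rightarrow> (real^2) set.
    subdivides n R (polygon_region n P) \<and>
    (\<forall>i<n. convex (R i) \<and>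
           polygon_side n P i edge_of R i \<and>
           A ` {..<m} \<inter> frontier (R i) = {} \<and>
           card (A ` {..<m} \<inter> interior (R i)) = c i) \<and>
    (\<forall>i<n. \<forall>j<n. i \<noteq> j \<longrightarrow> \<not> overlap (R i) (R j))"
proof -
  obtain F where "edge_forms n P F"
    and F_int: "\<And>i x. \<lbrakk>i < n; x \<in> interior (polygon_region n P)\<rbrakk> \<Longrightarrow> 0 < F i \<bullet> homog x"
    using convex_polygon_edge_forms[OF assms(1)] by metis
  then interpret E: edge_forms n P F by simp
  have A: "0 < F i \<bullet> homog (A k)" if "k < m" "i < n" for k i
    using F_int assms(3) that by auto
  obtain M0 where M0: "\<And>k. k < m \<Longrightarrow> M0 k < n" "\<And>i. i < n \<Longrightarrow> card {k \<in> {..<m}. M0 k = i} = c i"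
    using assignment_with_counts[OF assms(5)] by metis
  obtain s M1 where s: "\<And>i. 0 < s i" and M1: "\<And>k. k < m \<Longrightarrow> M1 k < n"
    "\<And>i. card {k \<in> {..<m}. M1 k = i} = card {k \<in> {..<m}. M0 k = i}"
    "\<And>k i. \<lbrakk>k < m; i < n\<rbrakk> \<Longrightarrow> s (M1 k) *\<^sub>R F (M1 k) \<bullet> homog (A k) \<le> s i *\<^sub>R F i \<bullet> homog (A k)"
    by (rule E.rescaled_assignment[of m A M0]) (use A M0 in auto)
  interpret S: edge_forms n P "\<lambda>i. s i *\<^sub>R F i" by (rule E.scaled_edge_forms[OF s])
  interpret tied_forms n P "\<lambda>i. s i *\<^sub>R F i" m A
  proof
    show "0 < s i *\<^sub>R F i \<bullet> homog (A k)" if "k < m" "i < n" for k i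
      using A that s by simp
    show "A k \<in> polygon_region n P" if "k < m" for k
      using assms(3) interior_subset that by blast
  qed (rule assms(2,4))+
  show ?thesis
  \<comment> \<open>\<open>M1\<close> has the required counts and picks a minimal form at each
    point, that is, one of the ties.\<close>
  proof (rule perturbed_forms[of M1])
    fix k assume k: "k < m"
    obtain i where "i < n" "low k = s i *\<^sub>R F i \<bullet> homog (A k)" by (rule low_attained)
    then show "M1 k \<in> ties k"
      unfolding ties_iff[OF k] using M1(1)[OF k] M1(3)[OF k] low_le[OF M1(1)[OF k], of k]
      by (auto intro: antisym)
  next
    fix G M
    assume GM: "\<And>i. i < n \<Longrightarrow> G i \<bullet> homog (P (Suc i mod n)) = G (Suc i mod n) \<bullet> homog (P (Suc i mod n))"
      "\<And>i v. \<lbrakk>i < n; v < n; v \<noteq> i; v \<noteq> Suc i mod n\<rbrakk> \<Longrightarrow> G v \<bullet> homog (P v) < G i \<bullet> homog (P v)"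
      "\<And>k. k < m \<Longrightarrow> M k < n"
      "\<And>k i. \<lbrakk>k < m; i < n; i \<noteq> M k\<rbrakk> \<Longrightarrow> G (M k) \<bullet> homog (A k) < G i \<bullet> homog (A k)"
      and M: "\<And>i. card {k \<in> {..<m}. M k = i} = card {k \<in> {..<m}. M1 k = i}"
    show ?thesis
    proof (rule subdivision_from_forms[where n = n and P = P and G = G and A = A and m = m and M = M])
      fix R
      assume R: "subdivides n R (polygon_region n P)"
        "\<And>i. i < n \<Longrightarrow> convex (R i) \<and> polygon_side n P i edge_of R i \<and>
           A ` {..<m} \<inter> frontier (R i) = {} \<and>
           card (A ` {..<m} \<inter> interior (R i)) = card {k \<in> {..<m}. M k = i}"
        "\<And>i j. \<lbrakk>i < n; j < n; i \<noteq> j\<rbrakk> \<Longrightarrow> \<not> overlap (R i) (R j)"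
      have "card {k \<in> {..<m}. M k = i} = c i" if "i < n" for i
        using M M1(2) M0(2)[OF that] by simp
      then have "\<forall>i<n. convex (R i) \<and> polygon_side n P i edge_of R i \<and>
           A ` {..<m} \<inter> frontier (R i) = {} \<and> card (A ` {..<m} \<inter> interior (R i)) = c i"
        using R(2) by simp
      moreover have "\<forall>i<n. \<forall>j<n. i \<noteq> j \<longrightarrow> \<not> overlap (R i) (R j)" using R(3) by simp
      ultimately show ?thesis using R(1) by blast
    qed (rule assms GM; assumption)+
  qed
qed

end
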